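(* Let $M=2$. Consider the two-group Curie-Weiss model with heterogeneous (i.e. positive definite) coupling matrix $J$ in the critical regime, and write $$J^{-1}=\begin{pmatrix}L_1&-\bar L\\-\bar L&L_2\end{pmatrix}.$$ Then $$\left(\frac{S_1}{N_1^{3/4}},\frac{S_2}{N_2^{3/4}}\right)\Longrightarrow\mu\quad\text{as }N\to\infty,$$ where $\mu$ is a probability measure on $\mathbb{R}^2$ whose moments $m_{K,Q}(\mu)$ of order $(K,Q)$ are given by $$m_{K,Q}(\mu)=\left[\frac{12}{\alpha_1(L_2-\alpha_2)^2+\alpha_2(L_1-\alpha_1)^2}\right]^{\frac{K+Q}{4}}(L_1-\alpha_1)^{\frac Q2}(L_2-\alpha_2)^{\frac K2}\,\frac{\Gamma\left(\frac{K+Q+1}{4}\right)}{\Gamma\left(\frac14\right)}\,\alpha_1^{\frac K4}\alpha_2^{\frac Q4}$$ if $K+Q$ is even, and $m_{K,Q}(\mu)=0$ otherwise.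
   Context: Setting. For each $N$ there are group sizes $N_1,N_2\in\mathbb{N}$ with $N_1+N_2=N$, and as $N\to\infty$ each $N_\lambda\to\infty$ and $N_\lambda/N\to\alpha_\lambda$, where $\alpha_\lambda\ge 0$ and $\alpha_1+\alpha_2=1$. For a fixed positive definite real symmetric $2\times2$ coupling matrix $J=(J_{\lambda\mu})$ (a heterogeneous coupling matrix), the two-group Curie-Weiss model is the collection of $\{-1,1\}$-valued random variables $X_{\lambda i}$ ($\lambda=1,2$, $1\le i\le N_\lambda$) with $$\mathbb{P}(X_{11}=x_{11},\ldots,X_{2N_2}=x_{2N_2})=Z^{-1}\exp\Big(\frac{1}{2N}\sum_{\lambda,\mu=1}^2 J_{\lambda\mu}\sum_{i=1}^{N_\lambda}\sum_{j=1}^{N_\mu}x_{\lambda i}x_{\mu j}\Big),$$ $Z$ being the normalising constant. Put $S_\lambda=\sum_{i=1}^{N_\lambda}X_{\lambda i}$. The critical regime is the case that $H=J^{-1}-\mathrm{diag}(\alpha_1,\alpha_2)$ is positive semi-definite but not positive definite. For $K,Q\in\mathbb{N}_0$ the moment of order $(K,Q)$ of $\mu$ is $m_{K,Q}(\mu)=\int x^Ky^Q\,\mathrm{d}\mu(x,y)$. $\Gamma$ is the Gamma function; $\Longrightarrow$ denotes weak convergence of the distributions.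
   Formalization: Added, as the claim fails or is undefined otherwise: the bracket's denominator is nonzero; L̄ ≥ 0 when α_1, α_2 > 0 (else m_{1,1} has the wrong sign); and √N·det(J^{-1} − diag(N_1/N, N_2/N)) → 0, as N_λ/N → α_λ alone does not give the limit. *)

theory Defs
  imports "HOL-Probability.Probability"
begin

definition pos_def :: "real^'g^'g \<Rightarrow> bool" where
  "pos_def A \<longleftrightarrow> transpose A = A \<and> (\<forall>x. x \<noteq> 0 \<longrightarrow> x \<bullet> (A *v x) > 0)"

definition pos_semidef :: "real^'g^'g \<Rightarrow> bool" where
  "pos_semidef A \<longleftrightarrow> transpose A = A \<and> (\<forall>x. x \<bullet> (A *v x) \<ge> 0)"

definition diag_matrix :: "real^'g \<Rightarrow> real^'g^'g" where
  "diag_matrix v = (\<chi> i j. if i = j then v $ i else 0)"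

definition cw_H :: "real^'g^'g \<Rightarrow> real^'g \<Rightarrow> real^'g^'g" where
  "cw_H J \<alpha> = matrix_inv J - diag_matrix \<alpha>"

text \<open>Criticality refers to the limiting proportions \<open>\<alpha>\<close>. At size \<open>N\<close> the quadratic part of the exponent
  involves \<open>cw_H J\<close> at the proportions \<open>N\<^sub>l / N\<close> instead; a limit law on the scale \<open>N\<^sub>l powr (3/4)\<close> needs the
  determinant of that matrix to be \<open>o(1 / sqrt N)\<close>, which does not follow from \<open>N\<^sub>l / N \<longlonglongrightarrow> \<alpha>\<^sub>l\<close> but
  does follow from \<open>sqrt N * (N\<^sub>l / N - \<alpha>\<^sub>l) \<longlonglongrightarrow> 0\<close>.\<close>

definition critical_regime :: "real^'g^'g \<Rightarrow> real^'g \<Rightarrow> bool" where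
  "critical_regime J \<alpha> \<longleftrightarrow> pos_semidef (cw_H J \<alpha>) \<and> \<not> pos_def (cw_H J \<alpha>)"

text \<open>The groups are the elements of a finite type; group \<open>l\<close> has the spins \<open>1, \<dots>, n l\<close>.\<close>

definition spin_configs :: "('g \<Rightarrow> nat) \<Rightarrow> ('g \<Rightarrow> nat \<Rightarrow> real) set" where
  "spin_configs n = PiE UNIV (\<lambda>l. PiE {1..n l} (\<lambda>_. {-1, 1}))"

definition cw_weight :: "real^'g^'g \<Rightarrow> ('g \<Rightarrow> nat) \<Rightarrow> ('g \<Rightarrow> nat \<Rightarrow> real) \<Rightarrow> real" where
  "cw_weight J n x = exp (1 / (2 * real (\<Sum>l\<in>UNIV. n l)) *
     (\<Sum>l\<in>UNIV. \<Sum>m\<in>UNIV. J $ l $ m * (\<Sum>i=1..n l. \<Sum>j=1..n m. x l i * x m j)))"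

definition cw_Z :: "real^'g^'g \<Rightarrow> ('g \<Rightarrow> nat) \<Rightarrow> real" where
  "cw_Z J n = (\<Sum>x\<in>spin_configs n. cw_weight J n x)"

definition curie_weiss ::
  "real^'g^'g \<Rightarrow> ('g \<Rightarrow> nat) \<Rightarrow> 'a measure \<Rightarrow> ('g \<Rightarrow> nat \<Rightarrow> 'a \<Rightarrow> real) \<Rightarrow> bool" where
  "curie_weiss J n M X \<longleftrightarrow> prob_space M \<and>
     (\<forall>l. \<forall>i\<in>{1..n l}. X l i \<in> borel_measurable M \<and> (\<forall>\<omega>\<in>space M. X l i \<omega> \<in> {-1, 1})) \<and>
     (\<forall>x\<in>spin_configs n.
        measure M {\<omega> \<in> space M. \<forall>l. \<forall>i\<in>{1..n l}. X l i \<omega> = x l i} = cw_weight J n x / cw_Z J n)"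

definition group_sum :: "('g \<Rightarrow> nat) \<Rightarrow> ('g \<Rightarrow> nat \<Rightarrow> 'a \<Rightarrow> real) \<Rightarrow> 'g \<Rightarrow> 'a \<Rightarrow> real" where
  "group_sum n X l \<omega> = (\<Sum>i=1..n l. X l i \<omega>)"

text \<open>The library's \<open>weak_conv_m\<close> is stated through distribution functions and only covers
  measures on the real line.\<close>

definition weakly_converges :: "(nat \<Rightarrow> 'b::topological_space measure) \<Rightarrow> 'b measure \<Rightarrow> bool" where
  "weakly_converges \<mu>s \<mu> \<longleftrightarrow>
     (\<forall>f :: 'b \<Rightarrow> real. continuous_on UNIV f \<and> bounded (range f) \<longrightarrow>
        (\<lambda>N. \<integral>p. f p \<partial>(\<mu>s N)) \<longlonglongrightarrow> (\<integral>p. f p \<partial>\<mu>))"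

definition moment :: "nat \<Rightarrow> nat \<Rightarrow> (real \<times> real) measure \<Rightarrow> real" where
  "moment K Q \<mu> = (\<integral>p. fst p ^ K * snd p ^ Q \<partial>\<mu>)"

text \<open>The powers with exponents \<open>K / 4\<close>, \<open>Q / 4\<close>, \<open>K / 2\<close>, \<open>Q / 2\<close> may have base \<open>0\<close> together with
  exponent \<open>0\<close>, where they must be \<open>1\<close>, whereas \<open>0 powr 0 = 0\<close>; they are therefore written as natural
  powers of roots. The base of the remaining power is positive whenever its denominator is nonzero.\<close>

definition critical_moment ::
  "real^2 \<Rightarrow> real \<Rightarrow> real \<Rightarrow> nat \<Rightarrow> nat \<Rightarrow> real" where
  "critical_moment \<alpha> L1 L2 K Q =
     (if even (K + Q)
      then (12 / (\<alpha> $ 1 * (L2 - \<alpha> $ 2)\<^sup>2 + \<alpha> $ 2 * (L1 - \<alpha> $ 1)\<^sup>2)) powr (real (K + Q) / 4)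
           * sqrt (L1 - \<alpha> $ 1) ^ Q * sqrt (L2 - \<alpha> $ 2) ^ K
           * (Gamma (real (K + Q + 1) / 4) / Gamma (1 / 4))
           * root 4 (\<alpha> $ 1) ^ K * root 4 (\<alpha> $ 2) ^ Q
      else 0)"

end

theory Submission
  imports Defs "HOL-Real_Asymp.Real_Asymp"
begin

text \<open>Hubbard--Stratonovich: conditionally on an auxiliary variable \<open>Y\<close> in the plane with density proportional to
  \<open>exp (- N * \<Phi> Y)\<close>, where \<open>\<Phi> y = y \<bullet> (matrix_inv J *v y) / 2 - (\<Sum>l. n l / N * ln (cosh (y $ l)))\<close>, the spins are
  independent with mean \<open>tanh (Y $ l)\<close>. The quadratic part of \<open>\<Phi>\<close> is \<open>cw_H J (n / N)\<close>, which is nearly singular.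
  Eliminating the coordinate \<open>2\<close> (if \<open>L2 > \<alpha> $ 2\<close>; otherwise exchange the groups) one writes
  \<open>Y = (u / c, (r * u + w / c) / c)\<close> with \<open>c = N powr (1/4)\<close>, so that \<open>w\<close> has a Gaussian limit and decouples,
  the determinant enters only as a vanishing coefficient of \<open>u\<^sup>2\<close>, and the quartic Taylor term of \<open>ln cosh\<close> gives
  \<open>u\<close> the limiting density proportional to \<open>exp (- \<kappa> * u ^ 4)\<close>. The lower bound
  \<open>y\<^sup>2 / 2 - ln (cosh y) \<ge> y ^ 4 / (12 * (1 + y\<^sup>2))\<close> makes these densities dominated, and by Chebyshev the sums
  concentrate at \<open>n l powr (3/4) * (n l powr (1/4) * tanh (Y $ l))\<close>. Hence the limit law is carried by a line,
  along which its moments are Gamma integrals.\<close>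

section \<open>The defect of \<open>ln cosh\<close> from its quadratic part\<close>

definition lncosh_defect :: "real \<Rightarrow> real" where
  "lncosh_defect y = y\<^sup>2 / 2 - ln (cosh y)"

lemma lncosh_defect_minus [simp]: "lncosh_defect (- y) = lncosh_defect y"
  by (simp add: lncosh_defect_def)

lemma cosh_eq_exp_lncosh_defect: "cosh y = exp (y\<^sup>2 / 2 - lncosh_defect y)"
  by (simp add: lncosh_defect_def cosh_real_pos)

lemma sinh_real_ge: "x \<le> sinh x" if "0 \<le> x" for x :: real
proof -
  have "sinh 0 - 0 \<le> sinh x - x"
  proof (rule DERIV_nonneg_imp_nondecreasing[OF that])
    fix t :: real
    show "\<exists>y. ((\<lambda>x. sinh x - x) has_real_derivative y) (at t) \<and> 0 \<le> y"
      by (rule exI[of _ "cosh t - 1"]) (auto intro!: derivative_eq_intros simp: cosh_real_ge_1)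
  qed
  then show ?thesis by simp
qed

text \<open>The map \<open>v / (1 + v)\<close> is increasing and \<open>tanh\<close> squared is its
  value at \<open>sinh\<close> squared, so everything reduces to
  \<open>x \<le> sinh x\<close>.\<close>

lemma tanh_square_ge: "x\<^sup>2 / (1 + x\<^sup>2) \<le> (tanh x)\<^sup>2" if "0 \<le> x" for x :: real
proof -
  have p: "0 < 1 + x\<^sup>2" by (simp add: add_pos_nonneg)
  have c: "0 < (cosh x)\<^sup>2" by (simp add: cosh_real_pos)
  have "x\<^sup>2 \<le> (sinh x)\<^sup>2"
    using sinh_real_ge[OF that] that by (intro power_mono) auto
  then have "x\<^sup>2 * (cosh x)\<^sup>2 \<le> (sinh x)\<^sup>2 * (1 + x\<^sup>2)"
    by (simp add: cosh_square_eq algebra_simps)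
  then show ?thesis
    using p c by (simp add: tanh_def power_divide divide_simps mult.commute)
qed

text \<open>Both sides vanish at \<open>0\<close> together with their first derivatives, so second
  derivatives are compared; that of the defect is \<open>tanh\<close> squared. The \<open>12\<close>
  is the one of the Taylor term \<open>y ^ 4 / 12\<close>, and the divisor
  \<open>1 + y\<^sup>2\<close> accounts for the merely quadratic growth of the defect.\<close>

lemma lncosh_defect_ge: "y ^ 4 / (1 + y\<^sup>2) / 12 \<le> lncosh_defect y"
proof -
  have nonneg: "x ^ 4 / (1 + x\<^sup>2) / 12 \<le> lncosh_defect x" if x: "0 \<le> x" for x :: real
  proof -
    have pos: "0 < 1 + t\<^sup>2" "1 + t\<^sup>2 \<noteq> 0" for t :: real
      using zero_le_power2[of t] by linarith+
    \<comment> \<open>By polynomial division this is \<open>t ^ 4 / (1 + t\<^sup>2)\<close>, in a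
      form that is easy to differentiate; \<open>g1\<close> and \<open>g2\<close> are its first two
      derivatives.\<close>
    define g where "g t = t\<^sup>2 - 1 + 1 / (1 + t\<^sup>2)" for t :: real
    define g1 where "g1 t = 2 * t - 2 * t / (1 + t\<^sup>2)\<^sup>2" for t :: real
    define g2 where "g2 t = 2 - 2 / (1 + t\<^sup>2)\<^sup>2 + 8 * t\<^sup>2 / (1 + t\<^sup>2) ^ 3" for t :: real
    have dg: "(g has_real_derivative g1 t) (at t)" for t
      unfolding g_def g1_def using pos[of t]
      by (auto intro!: derivative_eq_intros simp: power2_eq_square)
    have dg1: "(g1 has_real_derivative g2 t) (at t)" for t
    proof -
      define s where "s = 1 + t\<^sup>2"
      have s: "s \<noteq> 0" "t * t = s - 1" using pos[of t] by (auto simp: s_def power2_eq_square)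
      have "(g1 has_real_derivative 2 - (2 * s\<^sup>2 - 2 * t * (2 * s * (2 * t))) / (s\<^sup>2 * s\<^sup>2)) (at t)"
        unfolding g1_def s_def using pos[of t]
        by (auto intro!: derivative_eq_intros)
      also have "2 * t * (2 * s * (2 * t)) = 8 * s * (s - 1)"
        unfolding s(2)[symmetric] by simp
      also have "2 - (2 * s\<^sup>2 - 8 * s * (s - 1)) / (s\<^sup>2 * s\<^sup>2) = 2 - 2 / s\<^sup>2 + 8 * (s - 1) / s ^ 3"
        using s(1) by (simp add: field_simps power2_eq_square power3_eq_cube)
      also have "\<dots> = g2 t"
        by (simp add: g2_def s_def)
      finally show ?thesis .
    qed
    have g2: "g2 t / 12 \<le> (tanh t)\<^sup>2" if "0 \<le> t" for t
    proof -
      define s where "s = 1 + t\<^sup>2"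
      have s: "1 \<le> s" "0 < s" by (simp_all add: s_def add_pos_nonneg)
      have "g2 t / 12 = (2 - 2 / s\<^sup>2 + 8 * (s - 1) / s ^ 3) / 12"
        by (simp add: g2_def s_def)
      \<comment> \<open>The factor \<open>(s - 1) / s\<close> is the lower bound for
        \<open>tanh\<close> squared from \<open>tanh_square_ge\<close>; the other factor is at most
        \<open>1\<close> because \<open>s\<close> is at least \<open>1\<close>.\<close>
      also have "\<dots> = ((s - 1) / s) * ((s\<^sup>2 + s + 4) / (6 * s\<^sup>2))"
        using \<open>0 < s\<close> by (simp add: field_simps power2_eq_square power3_eq_cube)
      also have "\<dots> \<le> ((s - 1) / s) * 1"
      proof (rule mult_left_mono)
        have "1 \<le> s\<^sup>2" "s \<le> s\<^sup>2"
          using s(1) by (simp_all add: self_le_power)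
        then have "s\<^sup>2 + s + 4 \<le> 6 * s\<^sup>2" by linarith
        then show "(s\<^sup>2 + s + 4) / (6 * s\<^sup>2) \<le> 1" using s(2) by simp
      qed (use s in simp)
      also have "\<dots> = t\<^sup>2 / (1 + t\<^sup>2)" by (simp add: s_def)
      finally show ?thesis using tanh_square_ge[OF that] by linarith
    qed
    have d1: "g1 t / 12 \<le> t - tanh t" if "0 \<le> t" for t
    proof -
      have "0 - tanh 0 - g1 0 / 12 \<le> t - tanh t - g1 t / 12"
      proof (rule DERIV_nonneg_imp_nondecreasing[OF that])
        fix u :: real assume "0 \<le> u"
        then show "\<exists>y. ((\<lambda>x. x - tanh x - g1 x / 12) has_real_derivative y) (at u) \<and> 0 \<le> y"
          using g2[of u]
          by (intro exI[of _ "1 - (1 - (tanh u)\<^sup>2) - g2 u / 12"] conjI)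
             (rule derivative_eq_intros dg1 refl | simp)+
      qed
      then show ?thesis by (simp add: g1_def)
    qed
    have "lncosh_defect 0 - g 0 / 12 \<le> lncosh_defect x - g x / 12"
    proof (rule DERIV_nonneg_imp_nondecreasing[OF x])
      fix u :: real assume "0 \<le> u"
      then show "\<exists>y. ((\<lambda>x. lncosh_defect x - g x / 12) has_real_derivative y) (at u) \<and> 0 \<le> y"
        using d1[of u] unfolding lncosh_defect_def
        by (intro exI[of _ "u - tanh u - g1 u / 12"])
           (auto intro!: derivative_eq_intros dg simp: tanh_def)
    qed
    moreover have "g x = x ^ 4 / (1 + x\<^sup>2)"
      unfolding g_def using pos[of x] by (simp add: field_simps power2_eq_square power4_eq_xxxx)
    moreover have "lncosh_defect 0 - g 0 / 12 = 0" by (simp add: lncosh_defect_def g_def)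
    ultimately have "0 \<le> lncosh_defect x - x ^ 4 / (1 + x\<^sup>2) / 12" by (simp only:)
    then show ?thesis by (simp only: diff_ge_0_iff_ge)
  qed
  show ?thesis
  proof (cases "0 \<le> y")
    case False
    then have "(- y) ^ 4 / (1 + (- y)\<^sup>2) / 12 \<le> lncosh_defect (- y)"
      by (intro nonneg) simp
    then show ?thesis by (simp only: lncosh_defect_minus power2_minus power_minus_even even_numeral)
  qed (rule nonneg)
qed

text \<open>Since \<open>1 \<le> c\<close>, the denominator \<open>1 + (z / c)\<^sup>2\<close> in
  \<open>lncosh_defect_ge\<close> is at most \<open>1 + z\<^sup>2\<close>. The resulting bound is
  free of \<open>c\<close>, which later yields Gaussian tails uniform in \<open>N\<close>.\<close>

lemma scaled_lncosh_defect_ge: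
  assumes "1 \<le> c"
  shows "(z\<^sup>2 - 1) / 12 \<le> c ^ 4 * lncosh_defect (z / c)"
proof -
  have "z\<^sup>2 - 1 \<le> z ^ 4 / (1 + z\<^sup>2)"
  proof -
    have "(z\<^sup>2 - 1) * (1 + z\<^sup>2) \<le> z ^ 4" by (simp add: algebra_simps power2_eq_square power4_eq_xxxx)
    then show ?thesis by (simp add: pos_le_divide_eq add_pos_nonneg)
  qed
  also have "\<dots> \<le> z ^ 4 / (1 + (z / c)\<^sup>2)"
  proof -
    have "\<bar>z / c\<bar> \<le> \<bar>z\<bar>"
      using assms by (simp add: divide_le_eq mult_le_cancel_left1)
    then have "(z / c)\<^sup>2 \<le> z\<^sup>2"
      by (rule abs_le_square_iff[THEN iffD1])
    moreover have "0 < 1 + x\<^sup>2" for x :: real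
      by (simp add: add_pos_nonneg)
    ultimately show ?thesis
      by (intro divide_left_mono) simp_all
  qed
  also have "\<dots> = c ^ 4 * ((z / c) ^ 4 / (1 + (z / c)\<^sup>2))"
    using assms by (simp add: power_divide)
  also have "\<dots> \<le> c ^ 4 * (12 * lncosh_defect (z / c))"
  proof (rule mult_left_mono)
    show "(z / c) ^ 4 / (1 + (z / c)\<^sup>2) \<le> 12 * lncosh_defect (z / c)"
      using lncosh_defect_ge[of "z / c"] by (simp only: pos_divide_le_eq zero_less_numeral mult.commute)
  qed simp
  finally show ?thesis by simp
qed

text \<open>Carries a Taylor coefficient of \<open>g\<close> at \<open>0\<close> over to arguments
  that shrink like \<open>1 / c N\<close>; needed for \<open>lncosh_defect\<close> with
  \<open>k = 4\<close> and for \<open>tanh\<close> with \<open>k = 1\<close>.\<close>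

lemma tendsto_scaled:
  fixes g :: "real \<Rightarrow> real" and z c :: "nat \<Rightarrow> real"
  assumes g: "((\<lambda>y. g y / y ^ k) \<longlongrightarrow> l) (at 0)" and g0: "g 0 = 0" and k: "0 < k"
    and z: "z \<longlonglongrightarrow> z0" and c: "filterlim c at_top sequentially"
  shows "(\<lambda>N. c N ^ k * g (z N / c N)) \<longlonglongrightarrow> z0 ^ k * l"
proof -
  \<comment> \<open>Filling in the limit at \<open>0\<close> makes \<open>h\<close> continuous
    there; \<open>z N / c N\<close> may be \<open>0\<close> for some \<open>N\<close>.\<close>
  define h where "h y = (if y = 0 then l else g y / y ^ k)" for y
  have "isCont h 0"
  proof -
    have "(h \<longlongrightarrow> l) (at 0)"
      using g by (rule Lim_cong_within[THEN iffD1, rotated -1]) (auto simp: h_def)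
    then show ?thesis by (simp add: isCont_def h_def)
  qed
  moreover have "(\<lambda>N. z N / c N) \<longlonglongrightarrow> 0"
    by (rule real_tendsto_divide_at_top[OF z c])
  ultimately have "(\<lambda>N. h (z N / c N)) \<longlonglongrightarrow> h 0"
    by (rule isCont_tendsto_compose)
  then have "(\<lambda>N. z N ^ k * h (z N / c N)) \<longlonglongrightarrow> z0 ^ k * l"
    by (intro tendsto_intros z) (simp add: h_def)
  moreover have "eventually (\<lambda>N. z N ^ k * h (z N / c N) = c N ^ k * g (z N / c N)) sequentially"
    using filterlim_at_top_dense[THEN iffD1, OF c, rule_format, of 0]
    by eventually_elim (use k g0 in \<open>auto simp: h_def power_divide\<close>)
  ultimately show ?thesis by (rule Lim_transform_eventually)
qed

lemma scaled_lncosh_defect_tendsto: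
  assumes "z \<longlonglongrightarrow> z0" "filterlim c at_top sequentially"
  shows "(\<lambda>N. c N ^ 4 * lncosh_defect (z N / c N)) \<longlonglongrightarrow> z0 ^ 4 / 12"
proof -
  have "((\<lambda>y::real. (y\<^sup>2 / 2 - ln (cosh y)) / y ^ 4) \<longlongrightarrow> 1 / 12) (at 0)"
    unfolding cosh_def real_scaleR_def by real_asymp
  then have "((\<lambda>y. lncosh_defect y / y ^ 4) \<longlongrightarrow> 1 / 12) (at 0)"
    by (simp add: lncosh_defect_def)
  from tendsto_scaled[OF this _ _ assms] show ?thesis by (simp add: lncosh_defect_def)
qed

lemma scaled_tanh_tendsto:
  fixes z c :: "nat \<Rightarrow> real"
  assumes "z \<longlonglongrightarrow> z0" "filterlim c at_top sequentially"
  shows "(\<lambda>N. c N * tanh (z N / c N)) \<longlonglongrightarrow> z0"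
proof -
  have "((\<lambda>y::real. tanh y / y) \<longlongrightarrow> 1) (at 0)"
    unfolding tanh_def sinh_def cosh_def real_scaleR_def by real_asymp
  then have "((\<lambda>y::real. tanh y / y ^ 1) \<longlongrightarrow> 1) (at 0)" by simp
  from tendsto_scaled[OF this _ _ assms] show ?thesis by simp
qed

section \<open>Spins under an external field\<close>

definition spin_vectors :: "nat \<Rightarrow> (nat \<Rightarrow> real) set" where
  "spin_vectors k = PiE {1..k} (\<lambda>_. {-1, 1})"

lemma finite_spin_vectors [simp]: "finite (spin_vectors k)"
  unfolding spin_vectors_def by (intro finite_PiE) auto

definition spin_sum :: "nat \<Rightarrow> (real \<Rightarrow> real) \<Rightarrow> real" where
  "spin_sum k g = (\<Sum>x\<in>spin_vectors k. g (\<Sum>i=1..k. x i))"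

lemma spin_sum_0 [simp]: "spin_sum 0 g = g 0"
  by (simp add: spin_sum_def spin_vectors_def)

text \<open>Splitting off the last spin allows spin sums to be evaluated by induction on the number
  of spins.\<close>

lemma spin_sum_Suc: "spin_sum (Suc k) g = spin_sum k (\<lambda>s. g (s + 1) + g (s - 1))"
proof -
  let ?C = "spin_vectors k"
  let ?u = "\<lambda>(v, x). x(Suc k := v)"
  have eq: "{1..Suc k} = insert (Suc k) {1..k}" by auto
  have "spin_vectors (Suc k) = ?u ` ({-1, 1} \<times> ?C)"
    unfolding spin_vectors_def eq PiE_insert_eq by simp
  moreover have "inj_on ?u ({-1, 1} \<times> ?C)"
  proof (rule inj_onI, clarify)
    fix v w :: real and x y
    assume xy: "x \<in> ?C" "y \<in> ?C" and e: "x(Suc k := v) = y(Suc k := w)"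
    have "v = w" using fun_cong[OF e, of "Suc k"] by simp
    moreover have "x i = y i" for i
    proof (cases "i = Suc k")
      case True
      \<comment> \<open>Elements of \<open>spin_vectors k\<close> are extensional, so both are
        \<open>undefined\<close> at \<open>Suc k\<close>.\<close>
      then show ?thesis using xy by (auto simp: spin_vectors_def PiE_def extensional_def)
    next
      case False
      then show ?thesis using fun_cong[OF e, of i] by simp
    qed
    ultimately show "v = w \<and> x = y" by auto
  qed
  ultimately have "spin_sum (Suc k) g
      = (\<Sum>p\<in>{-1, 1} \<times> ?C. g (\<Sum>i=1..Suc k. ?u p i))"
    unfolding spin_sum_def by (simp add: sum.reindex)
  also have "\<dots> = (\<Sum>v\<in>{-1, 1}. \<Sum>x\<in>?C. g (\<Sum>i=1..Suc k. (x(Suc k := v)) i))"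
    by (subst sum.cartesian_product) (simp add: case_prod_unfold)
  also have "\<dots> = (\<Sum>v\<in>{-1, 1}. \<Sum>x\<in>?C. g ((\<Sum>i=1..k. x i) + v))"
    by (intro sum.cong refl arg_cong[of _ _ g]) (auto intro!: sum.cong)
  finally show ?thesis
    by (simp add: spin_sum_def sum.distrib add.commute)
qed

lemma spin_sum_cong: "(\<And>s. g s = h s) \<Longrightarrow> spin_sum k g = spin_sum k h"
  by (simp add: spin_sum_def)

lemma spin_sum_add: "spin_sum k (\<lambda>s. g s + h s) = spin_sum k g + spin_sum k h"
  by (simp add: spin_sum_def sum.distrib)

lemma spin_sum_cmult: "spin_sum k (\<lambda>s. a * g s) = a * spin_sum k g"
  by (simp add: spin_sum_def sum_distrib_left)

lemma spin_sum_multc: "spin_sum k (\<lambda>s. g s * a) = spin_sum k g * a"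
  by (simp add: spin_sum_def sum_distrib_right)

lemma spin_sum_divide: "spin_sum k (\<lambda>s. g s / a) = spin_sum k g / a"
  by (simp add: spin_sum_def sum_divide_distrib)

lemma spin_sum_mono: "(\<And>s. g s \<le> h s) \<Longrightarrow> spin_sum k g \<le> spin_sum k h"
  by (simp add: spin_sum_def sum_mono)

lemma spin_sum_swap:
  "spin_sum k (\<lambda>s. spin_sum l (g s)) = spin_sum l (\<lambda>t. spin_sum k (\<lambda>s. g s t))"
  by (simp add: spin_sum_def sum.swap[of _ "spin_vectors k"])

lemma spin_sum_exp: "spin_sum k (\<lambda>s. exp (y * s)) = (2 * cosh y) ^ k"
proof (induction k)
  case (Suc k)
  have "exp (y * (s + 1)) + exp (y * (s - 1)) = 2 * cosh y * exp (y * s)" for s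
    by (simp add: algebra_simps exp_add exp_diff cosh_def exp_minus divide_simps)
  with Suc show ?case by (simp add: spin_sum_Suc spin_sum_cmult)
qed simp

text \<open>Expectation of \<open>g\<close> at the sum of \<open>k\<close> independent spins with
  mean \<open>tanh y\<close>; by \<open>spin_sum_exp\<close> the divisor is the total
  weight.\<close>

definition tilted_mean :: "nat \<Rightarrow> real \<Rightarrow> (real \<Rightarrow> real) \<Rightarrow> real" where
  "tilted_mean k y g = spin_sum k (\<lambda>s. exp (y * s) * g s) / (2 * cosh y) ^ k"

lemma tilted_mean_Suc:
  "tilted_mean (Suc k) y g = tilted_mean k y
     (\<lambda>s. (exp y * g (s + 1) + exp (- y) * g (s - 1)) / (2 * cosh y))"
proof -
  have "spin_sum (Suc k) (\<lambda>s. exp (y * s) * g s)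
      = spin_sum k (\<lambda>s. exp (y * s) * (exp y * g (s + 1) + exp (- y) * g (s - 1)))"
    unfolding spin_sum_Suc by (rule spin_sum_cong) (simp add: algebra_simps exp_add exp_diff exp_minus divide_simps)
  then show ?thesis
    unfolding tilted_mean_def by (simp add: spin_sum_divide)
qed

lemma tilted_mean_const [simp]: "tilted_mean k y (\<lambda>_. a) = a"
  by (simp add: tilted_mean_def spin_sum_multc spin_sum_exp)

lemma tilted_mean_add: "tilted_mean k y (\<lambda>s. g s + h s) = tilted_mean k y g + tilted_mean k y h"
  by (simp add: tilted_mean_def distrib_left spin_sum_add add_divide_distrib)

lemma tilted_mean_cmult: "tilted_mean k y (\<lambda>s. a * g s) = a * tilted_mean k y g"
  using spin_sum_cmult[of k a "\<lambda>s. exp (y * s) * g s"]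
  by (simp add: tilted_mean_def algebra_simps)

lemma tilted_mean_mono: "(\<And>s. g s \<le> h s) \<Longrightarrow> tilted_mean k y g \<le> tilted_mean k y h"
  unfolding tilted_mean_def
  by (intro divide_right_mono spin_sum_mono mult_left_mono) (auto simp: cosh_real_pos less_imp_le)

lemma tilted_mean_abs_le: "\<bar>tilted_mean k y g\<bar> \<le> tilted_mean k y (\<lambda>s. \<bar>g s\<bar>)"
  using tilted_mean_mono[of g "\<lambda>s. \<bar>g s\<bar>" k y] tilted_mean_mono[of "\<lambda>s. - 1 * g s" "\<lambda>s. \<bar>g s\<bar>" k y]
  unfolding tilted_mean_cmult by fastforce

lemma exp_over_cosh: "exp y / (2 * cosh y) = (1 + tanh y) / 2" "exp (- y) / (2 * cosh y) = (1 - tanh (y::real)) / 2"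
proof -
  have "cosh y \<noteq> 0" by simp
  moreover have "exp y = cosh y + sinh y" "exp (- y) = cosh y - sinh y"
    by (simp_all add: cosh_def sinh_def field_simps)
  ultimately show "exp y / (2 * cosh y) = (1 + tanh y) / 2" "exp (- y) / (2 * cosh y) = (1 - tanh y) / 2"
    by (auto simp: tanh_def divide_simps)
qed

text \<open>The last spin is \<open>1\<close> with probability \<open>(1 + tanh y) / 2\<close>,
  which turns the first two moments into inductions.\<close>

lemma tilted_mean_Suc_tanh:
  "tilted_mean (Suc k) y g = tilted_mean k y
     (\<lambda>s. (1 + tanh y) / 2 * g (s + 1) + (1 - tanh y) / 2 * g (s - 1))"
  unfolding tilted_mean_Suc exp_over_cosh[symmetric] by (simp add: add_divide_distrib)

lemma tilted_mean_id: "tilted_mean k y (\<lambda>s. s) = real k * tanh y"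
proof (induction k)
  case 0
  then show ?case by (simp add: tilted_mean_def)
next
  case (Suc k)
  have "(1 + tanh y) / 2 * (s + 1) + (1 - tanh y) / 2 * (s - 1) = s + tanh y" for s
    by (simp add: field_simps)
  with Suc show ?case
    unfolding tilted_mean_Suc_tanh by (simp add: tilted_mean_add algebra_simps)
qed

lemma tilted_mean_square:
  "tilted_mean k y (\<lambda>s. s\<^sup>2) = (real k * tanh y)\<^sup>2 + real k * (1 - (tanh y)\<^sup>2)"
proof (induction k)
  case 0
  then show ?case by (simp add: tilted_mean_def)
next
  case (Suc k)
  have "(1 + tanh y) / 2 * (s + 1)\<^sup>2 + (1 - tanh y) / 2 * (s - 1)\<^sup>2 = s\<^sup>2 + ((2 * tanh y) * s + 1)" for s
    by (simp add: field_simps power2_eq_square)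
  with Suc show ?case
    unfolding tilted_mean_Suc_tanh
    by (simp add: tilted_mean_add tilted_mean_cmult tilted_mean_id) (simp add: field_simps power2_eq_square)
qed

text \<open>The mean square deviation from \<open>p\<close> is variance plus squared bias, and each
  spin has variance \<open>1 - (tanh y)\<^sup>2\<close>, at most \<open>1\<close>.\<close>

lemma tilted_mean_deviation_le:
  assumes "0 < m"
  shows "tilted_mean k y (\<lambda>s. (s / m - p)\<^sup>2) \<le> real k / m\<^sup>2 + (real k * tanh y / m - p)\<^sup>2"
proof -
  have "tilted_mean k y (\<lambda>s. (s / m - p)\<^sup>2)
      = tilted_mean k y (\<lambda>s. 1 / m\<^sup>2 * s\<^sup>2 + ((- 2 * p / m) * s + p\<^sup>2))"
    using assms by (intro arg_cong[of _ _ "tilted_mean k y"] ext) (simp add: power2_eq_square field_simps)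
  also have "\<dots> = real k * (1 - (tanh y)\<^sup>2) / m\<^sup>2 + (real k * tanh y / m - p)\<^sup>2"
    unfolding tilted_mean_add tilted_mean_cmult tilted_mean_id tilted_mean_square tilted_mean_const
    using assms by (simp add: power2_eq_square field_simps)
  also have "\<dots> \<le> real k / m\<^sup>2 + (real k * tanh y / m - p)\<^sup>2"
    by (intro add_right_mono divide_right_mono) (auto simp: algebra_simps)
  finally show ?thesis .
qed

section \<open>Integrals over the real line and the plane\<close>

text \<open>The substitution \<open>t = k * u ^ 4\<close> turns the Gamma integral at
  \<open>(m + 1) / 4\<close> into this one.\<close>

lemma quartic_exponential_moment_half:
  assumes k: "(0::real) < k"
  shows "has_bochner_integral lborel (\<lambda>u. indicator {0..} u *\<^sub>R (u ^ m * exp (- k * u ^ 4)))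
    (Gamma (real (m + 1) / 4) / (4 * k powr (real (m + 1) / 4)))"
proof -
  define x where "x = real (m + 1) / 4"
  have x: "0 < x" by (simp add: x_def)
  define g where "g u = k * u ^ 4" for u :: real
  define f where "f t = t powr (x - 1) / exp t" for t :: real
  \<comment> \<open>The integrands compared below can differ at \<open>0\<close>, where
    \<open>0 powr (x - 1) = 0\<close>; the open half line leaves out this null set.\<close>
  define S where "S = {0::real<..}"
  have spike: "(h has_integral I) {0..} \<longleftrightarrow> (h has_integral I) S" for h :: "real \<Rightarrow> real" and I
  proof (rule has_integral_spike_set_eq)
    show "negligible {u \<in> {0..} - S. h u \<noteq> 0}"
      by (rule negligible_subset[of "{0}"]) (auto simp: S_def)
    show "negligible {u \<in> S - {0..}. h u \<noteq> 0}"
      by (rule negligible_subset[of "{0}"]) (auto simp: S_def)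
  qed
  have inj: "inj_on g S"
    using k by (auto simp: inj_on_def g_def S_def power_eq_iff_eq_base)
  have img: "g ` S = S"
  proof (intro equalityI subsetI)
    fix t assume "t \<in> S"
    then have "t = g (root 4 (t / k))" "root 4 (t / k) \<in> S"
      using k by (auto simp: g_def S_def)
    then show "t \<in> g ` S" by blast
  qed (use k in \<open>auto simp: g_def S_def\<close>)
  have fS: "(f has_integral Gamma x) S"
    unfolding f_def using Gamma_integral_real[OF x] spike by blast
  then have "f absolutely_integrable_on g ` S \<and> integral (g ` S) f = Gamma x"
    unfolding img by (auto simp: f_def integral_unique intro!: nonnegative_absolutely_integrable_1)
  moreover have "(g has_field_derivative k * (4 * u ^ 3)) (at u within S)" for u
    unfolding g_def by (auto intro!: derivative_eq_intros)
  ultimately have "(\<lambda>u. \<bar>k * (4 * u ^ 3)\<bar> * f (g u)) absolutely_integrable_on S \<and>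
      integral S (\<lambda>u. \<bar>k * (4 * u ^ 3)\<bar> * f (g u)) = Gamma x"
    by (subst has_absolute_integral_change_of_variables_1'[OF _ _ inj]) (auto simp: S_def)
  then have "((\<lambda>u. \<bar>k * (4 * u ^ 3)\<bar> * f (g u)) has_integral Gamma x) S"
    by (metis absolutely_integrable_on_def has_integral_integral)
  moreover have "\<bar>k * (4 * u ^ 3)\<bar> * f (g u) = 4 * k powr x * (u ^ m * exp (- k * u ^ 4))" if "u \<in> S" for u
  proof -
    have u: "0 < u" using that by (simp add: S_def)
    have "k * (k * u ^ 4) powr (x - 1) * u ^ 3 = k powr x * u ^ m"
    proof -
      have "(k * u ^ 4) powr (x - 1) = k powr (x - 1) * u powr (4 * (x - 1))"
      proof -
        have "(u ^ 4) powr (x - 1) = (u powr 4) powr (x - 1)"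
          using u by (simp add: powr_numeral)
        then show ?thesis
          using k u by (simp only: powr_mult powr_powr less_imp_le zero_le_power)
      qed
      moreover have "k * k powr (x - 1) = k powr x"
        using k by (simp add: powr_mult_base)
      \<comment> \<open>By the choice of \<open>x\<close>,
        \<open>4 * (x - 1) + 3 = m\<close>.\<close>
      moreover have "u powr (4 * (x - 1)) * u ^ 3 = u ^ m"
      proof -
        have "u powr (4 * (x - 1)) * u ^ 3 = u powr (4 * (x - 1)) * u powr 3"
          using u by (simp add: powr_numeral)
        also have "\<dots> = u powr real m"
          unfolding powr_add[symmetric] by (intro arg_cong[of _ _ "(powr) u"]) (simp add: x_def field_simps)
        finally show ?thesis using u by (simp add: powr_realpow)
      qed
      ultimately show ?thesis by (metis mult.assoc mult.commute)
    qed
    then show ?thesis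
      using k u by (simp add: f_def g_def exp_minus field_simps)
  qed
  ultimately have "((\<lambda>u. 4 * k powr x * (u ^ m * exp (- k * u ^ 4))) has_integral Gamma x) S"
    by (rule has_integral_eq[rotated])
  then have "((\<lambda>u. 1 / (4 * k powr x) * (4 * k powr x * (u ^ m * exp (- k * u ^ 4)))) has_integral
      1 / (4 * k powr x) * Gamma x) S"
    by (rule has_integral_mult_right)
  then have "((\<lambda>u. u ^ m * exp (- k * u ^ 4)) has_integral Gamma x / (4 * k powr x)) {0..}"
    using k unfolding spike by simp
  then have "integral\<^sup>N lborel (\<lambda>u. indicator {0..} u * (u ^ m * exp (- k * u ^ 4))) = Gamma x / (4 * k powr x)"
    by (intro nn_integral_has_integral_lebesgue) auto
  then show ?thesis
    unfolding x_def[symmetric] using x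
    by (intro has_bochner_integral_nn_integral)
      (auto simp: indicator_def intro!: divide_nonneg_nonneg Gamma_real_nonneg)
qed

lemma quartic_exponential_moment:
  assumes "(0::real) < k"
  shows "has_bochner_integral lborel (\<lambda>u. u ^ m * exp (- k * u ^ 4))
    (if even m then Gamma (real (m + 1) / 4) / (2 * k powr (real (m + 1) / 4)) else 0)"
  using has_bochner_integral_even_function[OF quartic_exponential_moment_half[OF assms], of m]
    has_bochner_integral_odd_function[OF quartic_exponential_moment_half[OF assms], of m]
  by auto

lemma
  fixes f g :: "real \<Rightarrow> real"
  assumes f: "integrable lborel f" and g: "integrable lborel g"
  shows integrable_lborel_times: "integrable lborel (\<lambda>p. f (fst p) * g (snd p))"
    and integral_lborel_times: "(\<integral>p. f (fst p) * g (snd p) \<partial>lborel) = integral\<^sup>L lborel f * integral\<^sup>L lborel g"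
proof -
  have [measurable]: "f \<in> borel_measurable borel" "g \<in> borel_measurable borel"
    using f g by (auto dest: borel_measurable_integrable)
  have "integrable (lborel \<Otimes>\<^sub>M lborel) (\<lambda>p. f (fst p) * g (snd p))"
  proof (rule lborel_pair.Fubini_integrable)
    have "integrable lborel (\<lambda>x. \<bar>f x\<bar> * (\<integral>y. \<bar>g y\<bar> \<partial>lborel))"
      using f by (intro integrable_mult_left) auto
    then show "integrable lborel (\<lambda>x. \<integral>y. norm (f (fst (x, y)) * g (snd (x, y))) \<partial>lborel)"
      by (simp add: abs_mult)
  qed (use g in auto)
  note int = this
  then show "integrable lborel (\<lambda>p. f (fst p) * g (snd p))" by (simp add: lborel_prod)
  show "(\<integral>p. f (fst p) * g (snd p) \<partial>lborel) = integral\<^sup>L lborel f * integral\<^sup>L lborel g"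
    using lborel_pair.integral_fst'[OF int] by (simp add: lborel_prod)
qed

lemma has_bochner_integral_lborel_translation:
  fixes f :: "'a::euclidean_space \<Rightarrow> real"
  assumes f: "has_bochner_integral lborel f x"
  shows "has_bochner_integral lborel (\<lambda>p. f (c + p)) x"
proof -
  have [measurable]: "f \<in> borel_measurable borel"
    using f by (auto dest: borel_measurable_has_bochner_integral)
  have "has_bochner_integral (distr lborel borel ((+) c)) f x"
    using f by (simp add: lborel_distr_plus)
  then show ?thesis
    by (simp add: has_bochner_integral_iff integrable_distr_eq integral_distr)
qed

text \<open>The densities below are dominated only for large \<open>N\<close>, so dominated
  convergence is applied after a shift of the index.\<close>

lemma integral_tendsto_eventually_dominated:
  fixes s :: "nat \<Rightarrow> 'a \<Rightarrow> real"
  assumes f: "f \<in> borel_measurable M" and w: "integrable M w"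
    and s: "eventually (\<lambda>N. s N \<in> borel_measurable M) sequentially"
    and lim: "\<And>x. (\<lambda>N. s N x) \<longlonglongrightarrow> f x"
    and bound: "eventually (\<lambda>N. \<forall>x. \<bar>s N x\<bar> \<le> w x) sequentially"
  shows "(\<lambda>N. integral\<^sup>L M (s N)) \<longlonglongrightarrow> integral\<^sup>L M f"
proof -
  obtain N0 where N0: "\<And>N. N0 \<le> N \<Longrightarrow> s N \<in> borel_measurable M \<and> (\<forall>x. \<bar>s N x\<bar> \<le> w x)"
    using eventually_conj[OF s bound] by (auto simp: eventually_sequentially)
  have "(\<lambda>N. integral\<^sup>L M (s (N + N0))) \<longlonglongrightarrow> integral\<^sup>L M f"
    by (rule integral_dominated_convergence[OF f _ w])
       (use N0 in \<open>auto intro!: LIMSEQ_ignore_initial_segment lim\<close>)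
  then show ?thesis by (rule LIMSEQ_offset)
qed

lemma gaussian_exp_integral:
  assumes "(0::real) < h"
  shows "has_bochner_integral lborel (\<lambda>w. exp (- h * w\<^sup>2)) (sqrt (pi / h))"
proof -
  have "0 \<le> 1 / (2 * h)" "2 * pi * (1 / (2 * h)) = pi / h" "2 * (1 / (2 * h)) = 1 / h"
    using assms by simp_all
  \<comment> \<open>The centred normal density of variance \<open>1 / (2 * h)\<close>, freed from
    its normalising factor.\<close>
  then have d: "normal_density 0 (sqrt (1 / (2 * h))) w * sqrt (pi / h) = exp (- h * w\<^sup>2)" for w
    using assms by (simp add: normal_density_def real_sqrt_pow2 del: real_sqrt_divide)
  have "has_bochner_integral lborel (normal_density 0 (sqrt (1 / (2 * h)))) 1"
    using assms by (simp add: has_bochner_integral_iff)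
  from has_bochner_integral_mult_left[OF this, of "sqrt (pi / h)"] show ?thesis
    by (simp add: d)
qed

section \<open>Concentration and the Hubbard--Stratonovich identity\<close>

text \<open>On the scale \<open>n powr (3/4)\<close> a sum of \<open>n\<close> spins has variance at
  most \<open>n powr (- (1/2))\<close> and mean \<open>n powr (1/4) * tanh y\<close>. By Chebyshev
  the pair of sums concentrates at \<open>(p1, p2)\<close>, and \<open>f\<close> is continuous and
  bounded.\<close>

lemma tilted_mean_tendsto:
  fixes f :: "real \<times> real \<Rightarrow> real" and n1 n2 :: "nat \<Rightarrow> nat"
  assumes f: "continuous_on UNIV f" and B: "\<And>q. \<bar>f q\<bar> \<le> B"
    and n1: "filterlim n1 at_top sequentially" and n2: "filterlim n2 at_top sequentially"
    and p1: "(\<lambda>N. real (n1 N) powr (1/4) * tanh (y1 N)) \<longlonglongrightarrow> p1"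
    and p2: "(\<lambda>N. real (n2 N) powr (1/4) * tanh (y2 N)) \<longlonglongrightarrow> p2"
  shows "(\<lambda>N. tilted_mean (n1 N) (y1 N) (\<lambda>s. tilted_mean (n2 N) (y2 N)
      (\<lambda>t. f (s / real (n1 N) powr (3/4), t / real (n2 N) powr (3/4))))) \<longlonglongrightarrow> f (p1, p2)"
    (is "?E \<longlonglongrightarrow> _")
proof (rule tendstoI)
  fix e :: real assume e: "0 < e"
  have "isCont f (p1, p2)"
    using f by (simp add: continuous_on_eq_continuous_at)
  then obtain d where d: "0 < d" and "\<And>q. dist q (p1, p2) < d \<Longrightarrow> dist (f q) (f (p1, p2)) < e / 2"
    using e unfolding continuous_at_eps_delta by (meson half_gt_zero)
  then have fd: "dist q (p1, p2) < d \<Longrightarrow> \<bar>f q - f (p1, p2)\<bar> < e / 2" for q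
    by (auto simp: dist_real_def)
  \<comment> \<open>Chosen so that at distance at least \<open>d\<close> the quadratic penalty is at
    least \<open>2 * B\<close>, a bound for the oscillation of \<open>f\<close>.\<close>
  define K where "K = 2 * B / d\<^sup>2"
  have "0 \<le> B" using B[of 0] by linarith
  then have K: "0 \<le> K" by (simp add: K_def)
  have bound: "\<bar>f (q1, q2) - f (p1, p2)\<bar> \<le> e / 2 + K * (q1 - p1)\<^sup>2 + K * (q2 - p2)\<^sup>2" for q1 q2
  proof (cases "dist (q1, q2) (p1, p2) < d")
    case True
    have "0 \<le> K * (q1 - p1)\<^sup>2" "0 \<le> K * (q2 - p2)\<^sup>2" using K by simp_all
    with fd[OF True] show ?thesis by linarith
  next
    case False
    have "d\<^sup>2 \<le> (dist (q1, q2) (p1, p2))\<^sup>2"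
      using False d by (intro power_mono) auto
    also have "\<dots> = (q1 - p1)\<^sup>2 + (q2 - p2)\<^sup>2"
      by (simp add: dist_prod_def dist_real_def)
    finally have "K * d\<^sup>2 \<le> K * ((q1 - p1)\<^sup>2 + (q2 - p2)\<^sup>2)"
      using K by (rule mult_left_mono)
    moreover have "K * d\<^sup>2 = 2 * B" using d by (simp add: K_def)
    moreover have "\<bar>f (q1, q2) - f (p1, p2)\<bar> \<le> 2 * B"
      using B[of "(q1, q2)"] B[of "(p1, p2)"] by linarith
    ultimately show ?thesis using e by (simp add: distrib_left)
  qed
  \<comment> \<open>The bound of \<open>tilted_mean_deviation_le\<close> with
    \<open>m = k powr (3/4)\<close>.\<close>
  define R where "R k y p = real k / (real k powr (3/4))\<^sup>2 + (real k * tanh y / real k powr (3/4) - p)\<^sup>2"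
    for k y p
  have R: "(\<lambda>N. R (k N) (y N) p) \<longlonglongrightarrow> 0"
    if k: "filterlim k at_top sequentially"
      and lim: "(\<lambda>N. real (k N) powr (1/4) * tanh (y N)) \<longlonglongrightarrow> p" for k y p
  proof -
    have top: "filterlim (\<lambda>N. real (k N)) at_top sequentially"
      using k by (rule filterlim_compose[OF filterlim_real_sequentially])
    have "(\<lambda>N. real (k N) powr (- (1/2)) + (real (k N) powr (1/4) * tanh (y N) - p)\<^sup>2) \<longlonglongrightarrow> 0 + (p - p)\<^sup>2"
      by (intro tendsto_intros lim tendsto_neg_powr top) simp
    moreover have "eventually (\<lambda>N. real (k N) powr (- (1/2)) + (real (k N) powr (1/4) * tanh (y N) - p)\<^sup>2
        = R (k N) (y N) p) sequentially"
      using filterlim_at_top_dense[THEN iffD1, OF top, rule_format, of 0]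
    proof eventually_elim
      case (elim N)
      define x where "x = real (k N)"
      have x: "0 < x" using elim by (simp add: x_def)
      have "(x powr (3/4))\<^sup>2 = x powr (3/2)"
        by (simp add: power2_eq_square powr_add[symmetric])
      then have "x / (x powr (3/4))\<^sup>2 = x powr (- (1/2))"
        using x powr_diff[of x 1 "3/2"] by simp
      moreover have "x / x powr (3/4) = x powr (1/4)"
        using x powr_diff[of x 1 "3/4"] by simp
      then have "x * tanh (y N) / x powr (3/4) = x powr (1/4) * tanh (y N)"
        by (metis times_divide_eq_left)
      ultimately show ?case by (simp add: R_def x_def)
    qed
    ultimately have "(\<lambda>N. R (k N) (y N) p) \<longlonglongrightarrow> 0 + (p - p)\<^sup>2"
      by (rule Lim_transform_eventually)
    then show ?thesis by simp
  qed
  have "(\<lambda>N. K * R (n1 N) (y1 N) p1 + K * R (n2 N) (y2 N) p2) \<longlonglongrightarrow> K * 0 + K * 0"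
    by (intro tendsto_intros R n1 n2 p1 p2)
  then have "eventually (\<lambda>N. K * R (n1 N) (y1 N) p1 + K * R (n2 N) (y2 N) p2 < e / 2) sequentially"
    using e by (intro order_tendstoD(2)) auto
  moreover have "eventually (\<lambda>N. 0 < n1 N) sequentially" "eventually (\<lambda>N. 0 < n2 N) sequentially"
    using eventually_compose_filterlim[OF eventually_gt_at_top[of 0] n1]
      eventually_compose_filterlim[OF eventually_gt_at_top[of 0] n2] .
  ultimately show "eventually (\<lambda>N. dist (?E N) (f (p1, p2)) < e) sequentially"
  proof eventually_elim
    case (elim N)
    let ?m1 = "real (n1 N) powr (3/4)" and ?m2 = "real (n2 N) powr (3/4)"
    let ?T1 = "tilted_mean (n1 N) (y1 N)" and ?T2 = "tilted_mean (n2 N) (y2 N)"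
    let ?p = "(p1, p2)"
    have m: "0 < ?m1" "0 < ?m2" using elim by simp_all
    have "\<bar>?E N - f ?p\<bar> = \<bar>?T1 (\<lambda>s. ?T2 (\<lambda>t. f (s / ?m1, t / ?m2) + (- f ?p)))\<bar>"
      by (simp only: tilted_mean_add tilted_mean_const diff_conv_add_uminus)
    also have "\<dots> \<le> ?T1 (\<lambda>s. \<bar>?T2 (\<lambda>t. f (s / ?m1, t / ?m2) + (- f ?p))\<bar>)"
      by (rule tilted_mean_abs_le)
    also have "\<dots> \<le> ?T1 (\<lambda>s. ?T2 (\<lambda>t. \<bar>f (s / ?m1, t / ?m2) + (- f ?p)\<bar>))"
      by (rule tilted_mean_mono, rule tilted_mean_abs_le)
    also have "\<dots> \<le> ?T1 (\<lambda>s. ?T2 (\<lambda>t. e / 2 + K * (s / ?m1 - p1)\<^sup>2 + K * (t / ?m2 - p2)\<^sup>2))"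
      by (rule tilted_mean_mono, rule tilted_mean_mono) (use bound in simp)
    also have "\<dots> = e / 2 + K * ?T1 (\<lambda>s. (s / ?m1 - p1)\<^sup>2) + K * ?T2 (\<lambda>t. (t / ?m2 - p2)\<^sup>2)"
      by (simp only: tilted_mean_add tilted_mean_cmult tilted_mean_const)
    also have "\<dots> \<le> e / 2 + K * R (n1 N) (y1 N) p1 + K * R (n2 N) (y2 N) p2"
      unfolding R_def using m K by (intro add_mono mult_left_mono tilted_mean_deviation_le order_refl)
    also have "\<dots> < e" using elim by linarith
    finally show ?case by (simp add: dist_real_def)
  qed
qed

text \<open>By \<open>inv\<close>, the matrix with entries \<open>j11\<close>, \<open>j12\<close>,
  \<open>j22\<close> is inverse to that of \<open>Q\<close>, so a shift by its value at
  \<open>(s, t)\<close>, divided by \<open>N\<close>, completes the square. Since \<open>Y1\<close>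
  and \<open>Y2\<close> are linear in \<open>p\<close>, this is a translation of \<open>p\<close>;
  the Gaussian integral reappears unevaluated and no Jacobian arises.\<close>

lemma hubbard_stratonovich:
  fixes L1 L2 b j11 j12 j22 \<rho> N c d s t :: real
  assumes inv: "j11 * L1 - j12 * b = 1" "j12 * L2 - j11 * b = 0" "j12 * L1 - j22 * b = 0" "j22 * L2 - j12 * b = 1"
    and N: "N \<noteq> 0" and c: "c \<noteq> 0" and d: "d \<noteq> 0"
  defines "Q y1 y2 \<equiv> L1 * y1\<^sup>2 - 2 * b * y1 * y2 + L2 * y2\<^sup>2"
    and "Y1 p \<equiv> fst p / c" and "Y2 p \<equiv> \<rho> * fst p + snd p / d"
  assumes int: "integrable lborel (\<lambda>p. exp (- (N / 2) * Q (Y1 p) (Y2 p)))"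
  shows "has_bochner_integral lborel (\<lambda>p. exp (- (N / 2) * Q (Y1 p) (Y2 p) + (Y1 p * s + Y2 p * t)))
    (exp ((j11 * s\<^sup>2 + 2 * j12 * s * t + j22 * t\<^sup>2) / (2 * N)) * (\<integral>p. exp (- (N / 2) * Q (Y1 p) (Y2 p)) \<partial>lborel))"
    (is "has_bochner_integral _ ?F _")
proof -
  \<comment> \<open>The critical point \<open>(e1, e2)\<close> of the exponent as a function of
    \<open>(Y1, Y2)\<close>.\<close>
  define e1 where "e1 = (j11 * s + j12 * t) / N"
  define e2 where "e2 = (j12 * s + j22 * t) / N"
  \<comment> \<open>The point that \<open>Y1\<close> and \<open>Y2\<close> map to
    \<open>(e1, e2)\<close>.\<close>
  define a where "a = (c * e1, d * (e2 - \<rho> * (c * e1)))"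
  have Y: "Y1 (a + p) = e1 + Y1 p" "Y2 (a + p) = e2 + Y2 p" for p
    using c d by (simp_all add: Y1_def Y2_def a_def field_simps)
  have e: "N * (L1 * e1 - b * e2) = s" "N * (L2 * e2 - b * e1) = t"
  proof -
    have Ne: "N * e1 = j11 * s + j12 * t" "N * e2 = j12 * s + j22 * t"
      using N by (simp_all add: e1_def e2_def)
    have "N * (L1 * e1 - b * e2) = L1 * (N * e1) - b * (N * e2)"
      "N * (L2 * e2 - b * e1) = L2 * (N * e2) - b * (N * e1)"
      by (simp_all add: algebra_simps)
    then have "N * (L1 * e1 - b * e2) = (j11 * L1 - j12 * b) * s + (j12 * L1 - j22 * b) * t"
      "N * (L2 * e2 - b * e1) = (j12 * L2 - j11 * b) * s + (j22 * L2 - j12 * b) * t"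
      unfolding Ne by (simp_all add: algebra_simps)
    then show "N * (L1 * e1 - b * e2) = s" "N * (L2 * e2 - b * e1) = t"
      unfolding inv by simp_all
  qed
  have "- (N / 2) * Q (e1 + y1) (e2 + y2) + ((e1 + y1) * s + (e2 + y2) * t)
      = - (N / 2) * Q y1 y2 + (e1 * s + e2 * t) / 2" for y1 y2
    unfolding Q_def e[symmetric] by (simp add: field_simps power2_eq_square)
  then have eq: "?F (a + p) = exp ((e1 * s + e2 * t) / 2) * exp (- (N / 2) * Q (Y1 p) (Y2 p))" for p
    unfolding Y by (simp only: exp_add mult.commute)
  have F: "?F p = exp ((e1 * s + e2 * t) / 2) * exp (- (N / 2) * Q (Y1 (- a + p)) (Y2 (- a + p)))" for p
    using eq[of "- a + p"] by (simp only: add_minus_cancel)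
  have const: "(e1 * s + e2 * t) / 2 = (j11 * s\<^sup>2 + 2 * j12 * s * t + j22 * t\<^sup>2) / (2 * N)"
    using N by (simp add: e1_def e2_def field_simps power2_eq_square)
  have "has_bochner_integral lborel (\<lambda>p. exp (- (N / 2) * Q (Y1 (- a + p)) (Y2 (- a + p))))
      (\<integral>p. exp (- (N / 2) * Q (Y1 p) (Y2 p)) \<partial>lborel)"
    using int by (intro has_bochner_integral_lborel_translation) (simp add: has_bochner_integral_iff)
  then show ?thesis
    unfolding F const[symmetric] by (rule has_bochner_integral_mult_right)
qed

section \<open>The two-group model in Hubbard--Stratonovich coordinates\<close>

lemma filterlim_powr_at_top:
  "0 < a \<Longrightarrow> filterlim (\<lambda>N. real N powr a) at_top sequentially"
  by real_asymp

text \<open>\<open>j11\<close>, \<open>j12\<close>, \<open>j22\<close> are the entries of the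
  coupling matrix and \<open>b\<close> is \<open>Lbar\<close>. By \<open>pivot\<close> the second
  coordinate can be eliminated; the locale is instantiated with the groups in either order.
  \<open>nondegenerate\<close> makes both the limiting quartic coefficient and the quadratic one of
  the dominating function positive.\<close>

locale critical_two_groups =
  fixes n1 n2 :: "nat \<Rightarrow> nat" and L1 L2 b j11 j12 j22 \<alpha>1 \<alpha>2 :: real
  assumes sizes: "\<And>N. n1 N + n2 N = N"
    and n1_top: "filterlim n1 at_top sequentially" and n2_top: "filterlim n2 at_top sequentially"
    and n1_ratio: "(\<lambda>N. real (n1 N) / real N) \<longlonglongrightarrow> \<alpha>1"
    and n2_ratio: "(\<lambda>N. real (n2 N) / real N) \<longlonglongrightarrow> \<alpha>2"
    and \<alpha>_nonneg: "0 \<le> \<alpha>1" "0 \<le> \<alpha>2"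
    and inverse: "j11 * L1 - j12 * b = 1" "j12 * L2 - j11 * b = 0"
      "j12 * L1 - j22 * b = 0" "j22 * L2 - j12 * b = 1"
    and pivot: "\<alpha>2 < L2"
    and det_small: "(\<lambda>N. sqrt (real N) * ((L1 - real (n1 N) / real N) * (L2 - real (n2 N) / real N) - b\<^sup>2)) \<longlonglongrightarrow> 0"
    and nondegenerate: "0 < \<alpha>1 + \<alpha>2 * (b / (L2 - \<alpha>2))\<^sup>2"
begin

definition "a1 N = real (n1 N) / real N"
definition "a2 N = real (n2 N) / real N"
definition "c N = real N powr (1/4)"
definition "h N = L2 - a2 N"
definition "r N = b / h N"
text \<open>\<open>sqrt (real N) / 2\<close> times the Schur complement of the entry
  \<open>h N\<close> in \<open>cw_H\<close> at the finite-size proportions.\<close>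

definition "\<epsilon> N = sqrt (real N) * ((L1 - a1 N) * h N - b\<^sup>2) / (2 * h N)"

abbreviation "h\<^sub>0 \<equiv> L2 - \<alpha>2"
abbreviation "r\<^sub>0 \<equiv> b / (L2 - \<alpha>2)"
text \<open>Coefficient of \<open>u ^ 4\<close> in the Taylor expansion of \<open>\<alpha>1 *
  lncosh_defect u + \<alpha>2 * lncosh_defect (r\<^sub>0 * u)\<close>.\<close>

definition "\<kappa> = (\<alpha>1 + \<alpha>2 * r\<^sub>0 ^ 4) / 12"

definition "z N p = r N * fst p + snd p / c N"
definition "Y1 N p = fst p / c N"
definition "Y2 N p = z N p / c N"
definition "Q y1 y2 = L1 * y1\<^sup>2 - 2 * b * y1 * y2 + L2 * y2\<^sup>2"

definition gauss :: "nat \<Rightarrow> real \<times> real \<Rightarrow> real" where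
  "gauss N p = exp (- (real N / 2) * Q (Y1 N p) (Y2 N p))"

definition weight :: "nat \<Rightarrow> real \<Rightarrow> real \<Rightarrow> real" where
  "weight N s t = exp ((j11 * s\<^sup>2 + 2 * j12 * s * t + j22 * t\<^sup>2) / (2 * real N))"

definition weighted_sum :: "nat \<Rightarrow> (real \<Rightarrow> real \<Rightarrow> real) \<Rightarrow> real" where
  "weighted_sum N f = spin_sum (n1 N) (\<lambda>s. spin_sum (n2 N) (\<lambda>t. weight N s t * f s t))"

text \<open>Up to a factor without \<open>f\<close>, its integral will be
  \<open>weighted_sum N f\<close>. The divisor \<open>2 ^ N\<close> turns the
  \<open>2 * cosh\<close> of each spin into \<open>cosh\<close>.\<close>

definition integrand :: "nat \<Rightarrow> (real \<Rightarrow> real \<Rightarrow> real) \<Rightarrow> real \<times> real \<Rightarrow> real" where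
  "integrand N f p = spin_sum (n1 N) (\<lambda>s. spin_sum (n2 N) (\<lambda>t.
      exp (- (real N / 2) * Q (Y1 N p) (Y2 N p) + (Y1 N p * s + Y2 N p * t)) * f s t)) / 2 ^ N"

definition mixing_density :: "nat \<Rightarrow> real \<times> real \<Rightarrow> real" where
  "mixing_density N p = gauss N p * cosh (Y1 N p) ^ n1 N * cosh (Y2 N p) ^ n2 N"

section \<open>Limits of the coefficients; limit and domination of the mixing density\<close>

lemma a1_lim: "a1 \<longlonglongrightarrow> \<alpha>1" and a2_lim: "a2 \<longlonglongrightarrow> \<alpha>2"
  using n1_ratio n2_ratio by (simp_all add: a1_def[abs_def] a2_def[abs_def])

lemma h_lim: "h \<longlonglongrightarrow> h\<^sub>0"
  unfolding h_def[abs_def] by (intro tendsto_intros a2_lim)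

lemma r_lim: "r \<longlonglongrightarrow> r\<^sub>0"
  unfolding r_def[abs_def] using pivot by (intro tendsto_intros h_lim) auto

lemma c_top: "filterlim c at_top sequentially"
  unfolding c_def[abs_def] by (rule filterlim_powr_at_top) simp

lemma \<epsilon>_lim: "\<epsilon> \<longlonglongrightarrow> 0"
proof -
  have "\<epsilon> \<longlonglongrightarrow> 0 / (2 * h\<^sub>0)"
    unfolding \<epsilon>_def[abs_def] using pivot det_small
    by (intro tendsto_intros h_lim) (auto simp: h_def a1_def a2_def)
  then show ?thesis by simp
qed

lemma z_lim: "(\<lambda>N. z N p) \<longlonglongrightarrow> r\<^sub>0 * fst p"
proof -
  have "(\<lambda>N. z N p) \<longlonglongrightarrow> r\<^sub>0 * fst p + 0"
    unfolding z_def by (intro tendsto_intros r_lim real_tendsto_divide_at_top[OF tendsto_const c_top])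
  then show ?thesis by simp
qed

lemma c_power4: "0 < N \<Longrightarrow> c N ^ 4 = real N" and c_power2: "0 < N \<Longrightarrow> (c N)\<^sup>2 = sqrt (real N)"
proof -
  assume N: "0 < N"
  show 2: "(c N)\<^sup>2 = sqrt (real N)"
    by (simp add: c_def power2_eq_square powr_add[symmetric] powr_half_sqrt)
  have "c N ^ 4 = ((c N)\<^sup>2)\<^sup>2" by simp
  also have "\<dots> = real N" unfolding 2 by simp
  finally show "c N ^ 4 = real N" .
qed

lemma a1_plus_a2: "0 < N \<Longrightarrow> a1 N + a2 N = 1"
  using sizes[of N] by (simp add: a1_def a2_def add_divide_distrib[symmetric] of_nat_add[symmetric] del: of_nat_add)

lemma a_nonneg: "0 \<le> a1 N" "0 \<le> a2 N"
  by (simp_all add: a1_def a2_def)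

text \<open>Completing the square at finite \<open>N\<close> puts the whole determinant into the coefficient \<open>\<epsilon> N\<close>.\<close>

lemma quadratic_part:
  assumes N: "0 < N" and h: "0 < h N"
  shows "real N / 2 * Q (Y1 N p) (Y2 N p)
    = h N / 2 * (snd p)\<^sup>2 + \<epsilon> N * (fst p)\<^sup>2 + real (n1 N) * ((Y1 N p)\<^sup>2 / 2) + real (n2 N) * ((Y2 N p)\<^sup>2 / 2)"
proof -
  define C where "C = c N"
  have C: "0 < C" using N by (simp add: C_def c_def)
  have NC: "real N = C ^ 4" "sqrt (real N) = C\<^sup>2"
    using c_power4[OF N] c_power2[OF N] by (simp_all add: C_def)
  have n: "real (n1 N) = a1 N * real N" "real (n2 N) = a2 N * real N"
    using N by (simp_all add: a1_def a2_def)
  define u w x where "u = fst p" and "w = snd p" and "x = r N"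
  have b: "b = x * h N" using h by (simp add: x_def r_def)
  have Y: "Y1 N p = u / C" "Y2 N p = (x * u + w / C) / C"
    by (simp_all add: Y1_def Y2_def z_def u_def w_def C_def x_def)
  have "real N / 2 * Q (Y1 N p) (Y2 N p) - a1 N * real N * ((Y1 N p)\<^sup>2 / 2) - a2 N * real N * ((Y2 N p)\<^sup>2 / 2)
     = real N / 2 * ((L1 - a1 N) * (Y1 N p)\<^sup>2 - 2 * b * Y1 N p * Y2 N p + h N * (Y2 N p)\<^sup>2)"
    by (simp add: Q_def h_def algebra_simps)
  also have "\<dots> = C ^ 4 / 2 * ((L1 - a1 N) * (u / C)\<^sup>2 - 2 * (x * h N) * (u / C) * ((x * u + w / C) / C)
      + h N * ((x * u + w / C) / C)\<^sup>2)"
    unfolding Y NC(1) unfolding b by simp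
  \<comment> \<open>The mixed terms in \<open>u\<close> and \<open>w\<close> cancel because
    \<open>b = x * h N\<close>.\<close>
  also have "\<dots> = h N / 2 * w\<^sup>2 + C\<^sup>2 * ((L1 - a1 N) - x\<^sup>2 * h N) / 2 * u\<^sup>2"
    using C by (simp add: field_simps power2_eq_square power4_eq_xxxx)
  also have "C\<^sup>2 * ((L1 - a1 N) - x\<^sup>2 * h N) / 2 = \<epsilon> N"
    using h unfolding \<epsilon>_def NC(2) unfolding b by (simp add: field_simps power2_eq_square)
  finally show ?thesis by (simp add: n u_def w_def)
qed

text \<open>The squares of \<open>Y1\<close> and \<open>Y2\<close> in \<open>quadratic_part\<close>
  cancel against the quadratic parts of \<open>ln cosh\<close>, so only the defects remain, with
  weights \<open>n1 N = a1 N * c N ^ 4\<close> and \<open>n2 N = a2 N * c N ^ 4\<close>.\<close>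

lemma mixing_density_eq:
  assumes N: "0 < N" and h: "0 < h N"
  shows "mixing_density N p = exp (- (h N / 2 * (snd p)\<^sup>2) - \<epsilon> N * (fst p)\<^sup>2
    - a1 N * (c N ^ 4 * lncosh_defect (fst p / c N)) - a2 N * (c N ^ 4 * lncosh_defect (z N p / c N)))"
proof -
  have cosh: "cosh y ^ k = exp (real k * (y\<^sup>2 / 2) - real k * lncosh_defect y)" for y k
    unfolding cosh_eq_exp_lncosh_defect[of y] by (simp add: exp_of_nat_mult[symmetric] algebra_simps)
  have n: "a1 N * c N ^ 4 = real (n1 N)" "a2 N * c N ^ 4 = real (n2 N)"
    using N c_power4[OF N] by (simp_all add: a1_def a2_def)
  have q: "- (real N / 2) * Q (Y1 N p) (Y2 N p) = - (h N / 2 * (snd p)\<^sup>2 + \<epsilon> N * (fst p)\<^sup>2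
      + real (n1 N) * ((Y1 N p)\<^sup>2 / 2) + real (n2 N) * ((Y2 N p)\<^sup>2 / 2))"
    using quadratic_part[OF N h, of p] by (simp only: minus_mult_left[symmetric])
  show ?thesis
    unfolding mixing_density_def gauss_def cosh mult.assoc[symmetric] n exp_add[symmetric] q
    unfolding Y1_def Y2_def by (rule arg_cong[of _ _ exp]) linarith
qed

lemma mixing_density_lim:
  "(\<lambda>N. mixing_density N p) \<longlonglongrightarrow> exp (- \<kappa> * fst p ^ 4) * exp (- (h\<^sub>0 / 2) * (snd p)\<^sup>2)"
proof -
  have "eventually (\<lambda>N. 0 < h N) sequentially"
    using order_tendstoD(1)[OF h_lim] pivot by simp
  then have "eventually (\<lambda>N. exp (- (h N / 2 * (snd p)\<^sup>2) - \<epsilon> N * (fst p)\<^sup>2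
    - a1 N * (c N ^ 4 * lncosh_defect (fst p / c N)) - a2 N * (c N ^ 4 * lncosh_defect (z N p / c N)))
      = mixing_density N p) sequentially"
    using eventually_gt_at_top[of 0] by eventually_elim (simp only: mixing_density_eq)
  moreover have "(\<lambda>N. exp (- (h N / 2 * (snd p)\<^sup>2) - \<epsilon> N * (fst p)\<^sup>2
    - a1 N * (c N ^ 4 * lncosh_defect (fst p / c N)) - a2 N * (c N ^ 4 * lncosh_defect (z N p / c N))))
    \<longlonglongrightarrow> exp (- (h\<^sub>0 / 2 * (snd p)\<^sup>2) - 0 * (fst p)\<^sup>2 - \<alpha>1 * (fst p ^ 4 / 12) - \<alpha>2 * ((r\<^sub>0 * fst p) ^ 4 / 12))"
    by (intro tendsto_intros h_lim \<epsilon>_lim a1_lim a2_lim scaled_lncosh_defect_tendsto z_lim c_top) simp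
  moreover have "exp (- (h\<^sub>0 / 2 * (snd p)\<^sup>2) - 0 * (fst p)\<^sup>2 - \<alpha>1 * (fst p ^ 4 / 12) - \<alpha>2 * ((r\<^sub>0 * fst p) ^ 4 / 12))
    = exp (- \<kappa> * fst p ^ 4) * exp (- (h\<^sub>0 / 2) * (snd p)\<^sup>2)"
    unfolding exp_add[symmetric] \<kappa>_def power_mult_distrib
    by (rule arg_cong[of _ _ exp]) (simp add: algebra_simps add_divide_distrib)
  ultimately show ?thesis
    using Lim_transform_eventually[rotated] by (simp only:)
qed

text \<open>The quadratic lower bound on the defects supplies a positive coefficient of
  \<open>(fst p)\<^sup>2\<close>, against which \<open>\<epsilon> N\<close>, of either sign, is
  negligible.\<close>

lemma mixing_density_bound:
  obtains \<eta> where "0 < \<eta>"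
    "eventually (\<lambda>N. \<forall>p. mixing_density N p \<le> exp 1 * (exp (- \<eta> * (fst p)\<^sup>2) * exp (- \<eta> * (snd p)\<^sup>2))) sequentially"
proof -
  \<comment> \<open>Limit of the coefficient of \<open>u\<^sup>2\<close>. The \<open>24\<close> in
    place of \<open>12\<close> comes from
    \<open>(X + V)\<^sup>2 \<ge> X\<^sup>2 / 2 - V\<^sup>2\<close> with
    \<open>X = r N * u\<close>.\<close>
  define A where "A = \<alpha>1 / 12 + \<alpha>2 * r\<^sub>0\<^sup>2 / 24"
  \<comment> \<open>The final halving puts \<open>\<eta>\<close> strictly below both limits, so the
    coefficients exceed it eventually.\<close>
  define \<eta> where "\<eta> = min A (h\<^sub>0 / 2) / 2"
  have "0 < A"
  proof -
    have "0 \<le> \<alpha>2 * r\<^sub>0\<^sup>2" using \<alpha>_nonneg by simp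
    then show ?thesis using nondegenerate \<alpha>_nonneg unfolding A_def by linarith
  qed
  then have \<eta>: "0 < \<eta>" "\<eta> < A" "\<eta> < h\<^sub>0 / 2"
    using pivot by (auto simp: \<eta>_def min_def)
  have ct: "filterlim (\<lambda>N. 12 * (c N)\<^sup>2) at_top sequentially"
    by (intro filterlim_tendsto_pos_mult_at_top[OF tendsto_const _ filterlim_pow_at_top] c_top) auto
  \<comment> \<open>Separating \<open>w\<close> from \<open>u\<close> inside \<open>z N p\<close>
    costs the coefficient of \<open>w\<^sup>2\<close> an amount that tends to
    \<open>0\<close>.\<close>
  have "(\<lambda>N. h N / 2 - a2 N / (12 * (c N)\<^sup>2)) \<longlonglongrightarrow> h\<^sub>0 / 2 - 0"
    by (intro tendsto_intros h_lim real_tendsto_divide_at_top[OF a2_lim ct]) simp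
  then have e1: "eventually (\<lambda>N. \<eta> < h N / 2 - a2 N / (12 * (c N)\<^sup>2)) sequentially"
    using \<eta> order_tendstoD(1)[of _ "h\<^sub>0 / 2" _ \<eta>] by simp
  have "(\<lambda>N. \<epsilon> N + a1 N / 12 + a2 N * (r N)\<^sup>2 / 24) \<longlonglongrightarrow> 0 + \<alpha>1 / 12 + \<alpha>2 * r\<^sub>0\<^sup>2 / 24"
    by (intro tendsto_intros a1_lim a2_lim r_lim \<epsilon>_lim) auto
  then have e2: "eventually (\<lambda>N. \<eta> < \<epsilon> N + a1 N / 12 + a2 N * (r N)\<^sup>2 / 24) sequentially"
    using \<eta> order_tendstoD(1)[of _ A _ \<eta>] by (simp add: A_def)
  have e3: "eventually (\<lambda>N. 0 < h N) sequentially"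
    using order_tendstoD(1)[OF h_lim] pivot by simp
  have e4: "eventually (\<lambda>N. 1 \<le> c N) sequentially"
    using c_top by (simp add: filterlim_at_top)
  have "eventually (\<lambda>N. \<forall>p. mixing_density N p \<le> exp 1 * (exp (- \<eta> * (fst p)\<^sup>2) * exp (- \<eta> * (snd p)\<^sup>2))) sequentially"
    using e1 e2 e3 e4 eventually_gt_at_top[of 0]
  proof eventually_elim
    case (elim N)
    show ?case
    proof
      fix p :: "real \<times> real"
      define u w where "u = fst p" and "w = snd p"
      define d1 d2 where "d1 = c N ^ 4 * lncosh_defect (u / c N)" and "d2 = c N ^ 4 * lncosh_defect (z N p / c N)"
      have C: "0 < c N" using elim by linarith
      have "a1 N * ((u\<^sup>2 - 1) / 12) \<le> a1 N * d1"
        unfolding d1_def using elim a_nonneg by (intro mult_left_mono scaled_lncosh_defect_ge) auto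
      moreover have "a2 N * (((r N)\<^sup>2 * u\<^sup>2 / 2 - w\<^sup>2 / (c N)\<^sup>2 - 1) / 12) \<le> a2 N * d2"
      proof (rule mult_left_mono)
        have "(X + V)\<^sup>2 - (X\<^sup>2 / 2 - V\<^sup>2) = (X + 2 * V)\<^sup>2 / 2" for X V :: real
          by (simp add: field_simps power2_eq_square)
        then have "X\<^sup>2 / 2 - V\<^sup>2 \<le> (X + V)\<^sup>2" for X V :: real
          by (smt (verit) zero_le_power2 divide_nonneg_pos)
        from this[of "r N * u" "w / c N"] have "(r N)\<^sup>2 * u\<^sup>2 / 2 - w\<^sup>2 / (c N)\<^sup>2 \<le> (z N p)\<^sup>2"
          by (simp add: z_def u_def w_def power_mult_distrib power_divide)
        then have "((r N)\<^sup>2 * u\<^sup>2 / 2 - w\<^sup>2 / (c N)\<^sup>2 - 1) / 12 \<le> ((z N p)\<^sup>2 - 1) / 12"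
          by (intro divide_right_mono diff_right_mono) simp_all
        also have "\<dots> \<le> d2"
          unfolding d2_def using elim by (intro scaled_lncosh_defect_ge) auto
        finally show "((r N)\<^sup>2 * u\<^sup>2 / 2 - w\<^sup>2 / (c N)\<^sup>2 - 1) / 12 \<le> d2" .
      qed (rule a_nonneg)
      moreover have "\<eta> * w\<^sup>2 \<le> (h N / 2 - a2 N / (12 * (c N)\<^sup>2)) * w\<^sup>2"
        "\<eta> * u\<^sup>2 \<le> (\<epsilon> N + a1 N / 12 + a2 N * (r N)\<^sup>2 / 24) * u\<^sup>2"
        using elim by (auto intro!: mult_right_mono)
      moreover have "a1 N * ((u\<^sup>2 - 1) / 12) = a1 N / 12 * u\<^sup>2 - a1 N / 12"
        by (simp add: field_simps)
      moreover have "a2 N * (((r N)\<^sup>2 * u\<^sup>2 / 2 - w\<^sup>2 / (c N)\<^sup>2 - 1) / 12)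
          = a2 N * (r N)\<^sup>2 / 24 * u\<^sup>2 - a2 N / (12 * (c N)\<^sup>2) * w\<^sup>2 - a2 N / 12"
        using C by (simp add: field_simps)
      \<comment> \<open>The constants add up to \<open>(a1 N + a2 N) / 12 = 1 / 12\<close>, which is
        rounded up to \<open>1\<close>.\<close>
      ultimately have "- (h N / 2 * w\<^sup>2) - \<epsilon> N * u\<^sup>2 - a1 N * d1 - a2 N * d2
          \<le> 1 + (- \<eta> * u\<^sup>2 + - \<eta> * w\<^sup>2)"
        using a1_plus_a2[of N] elim unfolding distrib_right left_diff_distrib by linarith
      then show "mixing_density N p \<le> exp 1 * (exp (- \<eta> * (fst p)\<^sup>2) * exp (- \<eta> * (snd p)\<^sup>2))"
        using elim by (simp only: mixing_density_eq exp_add[symmetric] exp_le_cancel_iff u_def w_def d1_def d2_def)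
    qed
  qed
  with \<eta>(1) show thesis by (rule that)
qed

section \<open>Integral representation of the weighted sums\<close>

text \<open>Given \<open>p\<close>, the exponent is linear in \<open>s\<close> and \<open>t\<close>,
  so the groups decouple into tilted means, whose normalising factors are the powers of
  \<open>cosh\<close>.\<close>

lemma integrand_eq:
  "integrand N f p = mixing_density N p * tilted_mean (n1 N) (Y1 N p) (\<lambda>s. tilted_mean (n2 N) (Y2 N p) (f s))"
proof -
  have "exp (- (real N / 2) * Q (Y1 N p) (Y2 N p) + (Y1 N p * s + Y2 N p * t)) * x
      = exp (Y1 N p * s) * (gauss N p * (exp (Y2 N p * t) * x))" for s t x
    by (simp only: exp_add gauss_def mult_ac)
  then have "integrand N f p = spin_sum (n1 N) (\<lambda>s. exp (Y1 N p * s) *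
      (gauss N p * spin_sum (n2 N) (\<lambda>t. exp (Y2 N p * t) * f s t))) / 2 ^ N"
    unfolding integrand_def by (simp only: spin_sum_cmult)
  also have "\<dots> = gauss N p * spin_sum (n1 N) (\<lambda>s. exp (Y1 N p * s) *
      spin_sum (n2 N) (\<lambda>t. exp (Y2 N p * t) * f s t)) / (2 ^ n1 N * 2 ^ n2 N)"
    \<comment> \<open>The exponent of \<open>2 ^ N\<close> is split so that each group takes its own
      power of \<open>2\<close>.\<close>
    by (subst (6) sizes[symmetric]) (simp add: spin_sum_cmult[symmetric] power_add mult_ac)
  finally show ?thesis
    unfolding mixing_density_def tilted_mean_def power_mult_distrib
    by (simp add: spin_sum_divide)
qed

lemma continuous_Y: "continuous_on UNIV (Y1 N)" "continuous_on UNIV (Y2 N)"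
  unfolding Y1_def[abs_def] Y2_def[abs_def] z_def divide_inverse by (intro continuous_intros)+

lemma continuous_gauss: "continuous_on UNIV (gauss N)"
  unfolding gauss_def[abs_def] Q_def
  by (intro continuous_intros continuous_on_compose2[OF continuous_Y(1)] continuous_on_compose2[OF continuous_Y(2)]) auto

lemma measurable_integrand: "integrand N f \<in> borel_measurable borel"
  unfolding integrand_def[abs_def] spin_sum_def Q_def
  by (intro borel_measurable_continuous_onI continuous_intros
      continuous_on_compose2[OF continuous_Y(1)] continuous_on_compose2[OF continuous_Y(2)]) auto

text \<open>Passes the Gaussian bound for the mixing density on to \<open>gauss\<close>, whose
  integrability the Hubbard--Stratonovich identity requires.\<close>

lemma gauss_le_mixing_density: "gauss N p \<le> mixing_density N p"
proof -
  have "1 * 1 \<le> cosh (Y1 N p) ^ n1 N * cosh (Y2 N p) ^ n2 N"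
    by (intro mult_mono one_le_power cosh_real_ge_1) auto
  then have "gauss N p * 1 \<le> gauss N p * (cosh (Y1 N p) ^ n1 N * cosh (Y2 N p) ^ n2 N)"
    by (intro mult_left_mono) (auto simp: gauss_def)
  then show ?thesis by (simp add: mixing_density_def mult.assoc)
qed

lemma mixing_density_nonneg: "0 \<le> mixing_density N p"
  unfolding mixing_density_def gauss_def by simp

text \<open>The Hubbard--Stratonovich identity is applied to every pair of spin vectors. The factor
  besides \<open>weighted_sum N f\<close> does not depend on \<open>f\<close>, so it will cancel in
  ratios.\<close>

lemma integral_integrand:
  assumes N: "0 < N" and int: "integrable lborel (gauss N)"
  shows "(\<integral>p. integrand N f p \<partial>lborel) = weighted_sum N f * ((\<integral>p. gauss N p \<partial>lborel) / 2 ^ N)"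
proof -
  have c: "c N \<noteq> 0" using N by (simp add: c_def)
  \<comment> \<open>The form of the second coordinate in \<open>hubbard_stratonovich\<close>, with
    \<open>d = (c N)\<^sup>2\<close>.\<close>
  have Y2: "Y2 N p = r N / c N * fst p + snd p / (c N)\<^sup>2" for p
    using c by (simp add: Y2_def z_def field_simps power2_eq_square)
  have summand: "has_bochner_integral lborel
      (\<lambda>p. exp (- (real N / 2) * Q (Y1 N p) (Y2 N p) + (Y1 N p * s + Y2 N p * t)) * f s t)
      (weight N s t * (\<integral>p. gauss N p \<partial>lborel) * f s t)" for s t
    using hubbard_stratonovich[OF inverse, of "real N" "c N" "(c N)\<^sup>2" "r N / c N" s t] N c int
    unfolding weight_def gauss_def[abs_def] Y2 Y1_def Q_def
    by (intro has_bochner_integral_mult_left) simp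
  have "has_bochner_integral lborel (integrand N f)
      (spin_sum (n1 N) (\<lambda>s. spin_sum (n2 N) (\<lambda>t. weight N s t * (\<integral>p. gauss N p \<partial>lborel) * f s t)) / 2 ^ N)"
    unfolding integrand_def[abs_def] spin_sum_def
    by (intro has_bochner_integral_divide_zero has_bochner_integral_sum summand)
  moreover have "spin_sum (n1 N) (\<lambda>s. spin_sum (n2 N) (\<lambda>t. weight N s t * (\<integral>p. gauss N p \<partial>lborel) * f s t))
      = (\<integral>p. gauss N p \<partial>lborel) * weighted_sum N f"
    unfolding weighted_sum_def spin_sum_cmult[symmetric] by (simp add: mult_ac)
  ultimately show ?thesis
    by (simp add: has_bochner_integral_iff)
qed

section \<open>Convergence of the integrals and of their ratios\<close>

lemma \<kappa>_pos: "0 < \<kappa>"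
proof -
  have "0 \<le> \<alpha>2 * r\<^sub>0 ^ 4" using \<alpha>_nonneg by simp
  moreover have "\<alpha>1 + \<alpha>2 * r\<^sub>0 ^ 4 \<noteq> 0"
  proof
    assume 0: "\<alpha>1 + \<alpha>2 * r\<^sub>0 ^ 4 = 0"
    with \<open>0 \<le> \<alpha>2 * r\<^sub>0 ^ 4\<close> have "\<alpha>1 = 0" "\<alpha>2 * r\<^sub>0 ^ 4 = 0" using \<alpha>_nonneg by linarith+
    then show False using nondegenerate by auto
  qed
  ultimately have "0 < \<alpha>1 + \<alpha>2 * r\<^sub>0 ^ 4" using \<alpha>_nonneg by linarith
  then show ?thesis by (simp add: \<kappa>_def)
qed

definition scaled :: "(real \<times> real \<Rightarrow> real) \<Rightarrow> nat \<Rightarrow> real \<Rightarrow> real \<Rightarrow> real" where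
  "scaled f N s t = f (s / real (n1 N) powr (3/4), t / real (n2 N) powr (3/4))"

text \<open>Eventually \<open>real (k N) powr (1/4)\<close> is
  \<open>root 4 (real (k N) / real N) * c N\<close>, which links the normalisation by group size to
  the scale \<open>c N\<close>. Continuity of \<open>root 4\<close> at \<open>0\<close> covers a
  vanishing proportion.\<close>

lemma root_scaled_tanh_tendsto:
  assumes k: "filterlim k at_top sequentially" and ratio: "(\<lambda>N. real (k N) / real N) \<longlonglongrightarrow> \<alpha>"
    and x: "x \<longlonglongrightarrow> x0"
  shows "(\<lambda>N. real (k N) powr (1/4) * tanh (x N / c N)) \<longlonglongrightarrow> root 4 \<alpha> * x0"
proof -
  have "(\<lambda>N. root 4 (real (k N) / real N) * (c N * tanh (x N / c N))) \<longlonglongrightarrow> root 4 \<alpha> * x0"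
    by (intro tendsto_mult tendsto_real_root ratio scaled_tanh_tendsto x c_top)
  moreover have "eventually (\<lambda>N. root 4 (real (k N) / real N) * (c N * tanh (x N / c N))
      = real (k N) powr (1/4) * tanh (x N / c N)) sequentially"
    using eventually_compose_filterlim[OF eventually_gt_at_top[of 0] k] eventually_gt_at_top[of 0]
  proof eventually_elim
    case (elim N)
    then have "root 4 (real (k N) / real N) * c N = real (k N) powr (1/4)"
      by (simp add: root_powr_inverse c_def powr_divide)
    then show ?case by (metis mult.assoc)
  qed
  ultimately show ?thesis by (rule Lim_transform_eventually)
qed

text \<open>Dominated convergence in the plane. In the limit the argument of \<open>f\<close>
  involves only \<open>u = fst p\<close>, so the integral factors and the Gaussian in
  \<open>snd p\<close> splits off.\<close>

lemma integral_integrand_tendsto: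
  fixes f :: "real \<times> real \<Rightarrow> real"
  assumes f: "continuous_on UNIV f" and B: "\<And>q. \<bar>f q\<bar> \<le> B"
  shows "(\<lambda>N. \<integral>p. integrand N (scaled f N) p \<partial>lborel) \<longlonglongrightarrow>
    (\<integral>u. exp (- \<kappa> * u ^ 4) * f (root 4 \<alpha>1 * u, root 4 \<alpha>2 * r\<^sub>0 * u) \<partial>lborel) * (\<integral>w. exp (- (h\<^sub>0 / 2) * w\<^sup>2) \<partial>lborel)"
proof -
  obtain \<eta> where \<eta>: "0 < \<eta>" and bound: "eventually (\<lambda>N. \<forall>p. mixing_density N p
      \<le> exp 1 * (exp (- \<eta> * (fst p)\<^sup>2) * exp (- \<eta> * (snd p)\<^sup>2))) sequentially"
    by (rule mixing_density_bound)
  have "0 \<le> B" using B[of 0] by linarith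
  define v where "v u = exp (- \<kappa> * u ^ 4) * f (root 4 \<alpha>1 * u, root 4 \<alpha>2 * r\<^sub>0 * u)" for u
  have v: "continuous_on UNIV v"
    unfolding v_def by (intro continuous_intros continuous_on_compose2[OF f]) auto
  have int_v: "integrable lborel v"
  proof (rule Bochner_Integration.integrable_bound)
    have "integrable lborel (\<lambda>u. u ^ 0 * exp (- \<kappa> * u ^ 4))"
      using quartic_exponential_moment[OF \<kappa>_pos, of 0] by (simp only: has_bochner_integral_iff)
    then show "integrable lborel (\<lambda>u. B * exp (- \<kappa> * u ^ 4))" by simp
    show "v \<in> borel_measurable lborel"
      using v by (simp add: borel_measurable_continuous_onI)
    show "AE u in lborel. norm (v u) \<le> norm (B * exp (- \<kappa> * u ^ 4))"
      using B \<open>0 \<le> B\<close> by (auto simp: v_def abs_mult mult.commute intro!: mult_left_mono)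
  qed
  have int_g: "integrable lborel (\<lambda>w::real. exp (- a * w\<^sup>2))" if "0 < a" for a
    using gaussian_exp_integral[OF that] by (simp only: has_bochner_integral_iff)
  have "(\<lambda>N. \<integral>p. integrand N (scaled f N) p \<partial>lborel) \<longlonglongrightarrow> (\<integral>p. v (fst p) * exp (- (h\<^sub>0 / 2) * (snd p)\<^sup>2) \<partial>lborel)"
  proof (rule integral_tendsto_eventually_dominated)
    show "(\<lambda>p. v (fst p) * exp (- (h\<^sub>0 / 2) * (snd p)\<^sup>2)) \<in> borel_measurable lborel"
      using integrable_lborel_times[OF int_v int_g[of "h\<^sub>0 / 2"]] pivot by (auto dest: borel_measurable_integrable)
    show "integrable lborel (\<lambda>p. exp 1 * B * (exp (- \<eta> * (fst p)\<^sup>2) * exp (- \<eta> * (snd p)\<^sup>2)))"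
      using integrable_lborel_times[OF int_g[OF \<eta>] int_g[OF \<eta>]] by simp
    show "eventually (\<lambda>N. integrand N (scaled f N) \<in> borel_measurable lborel) sequentially"
      using measurable_integrand by simp
    show "eventually (\<lambda>N. \<forall>p. \<bar>integrand N (scaled f N) p\<bar>
        \<le> exp 1 * B * (exp (- \<eta> * (fst p)\<^sup>2) * exp (- \<eta> * (snd p)\<^sup>2))) sequentially"
      using bound
    proof eventually_elim
      case (elim N)
      show ?case
      proof
        fix p
        let ?E = "tilted_mean (n1 N) (Y1 N p) (\<lambda>s. tilted_mean (n2 N) (Y2 N p) (scaled f N s))"
        have "\<bar>?E\<bar> \<le> tilted_mean (n1 N) (Y1 N p) (\<lambda>s. \<bar>tilted_mean (n2 N) (Y2 N p) (scaled f N s)\<bar>)"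
          by (rule tilted_mean_abs_le)
        also have "\<dots> \<le> tilted_mean (n1 N) (Y1 N p) (\<lambda>s. tilted_mean (n2 N) (Y2 N p) (\<lambda>t. \<bar>scaled f N s t\<bar>))"
          by (rule tilted_mean_mono, rule tilted_mean_abs_le)
        also have "\<dots> \<le> tilted_mean (n1 N) (Y1 N p) (\<lambda>s. tilted_mean (n2 N) (Y2 N p) (\<lambda>t. B))"
          by (rule tilted_mean_mono, rule tilted_mean_mono) (simp add: scaled_def B)
        finally have "\<bar>?E\<bar> \<le> B" by simp
        then have "mixing_density N p * \<bar>?E\<bar> \<le> (exp 1 * (exp (- \<eta> * (fst p)\<^sup>2) * exp (- \<eta> * (snd p)\<^sup>2))) * B"
          using elim[rule_format, of p] by (intro mult_mono) simp_all
        then show "\<bar>integrand N (scaled f N) p\<bar> \<le> exp 1 * B * (exp (- \<eta> * (fst p)\<^sup>2) * exp (- \<eta> * (snd p)\<^sup>2))"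
          unfolding integrand_eq abs_mult using mixing_density_nonneg[of N p] by (simp only: abs_of_nonneg mult_ac)
      qed
    qed
    fix p :: "real \<times> real"
    have "(\<lambda>N. tilted_mean (n1 N) (Y1 N p) (\<lambda>s. tilted_mean (n2 N) (Y2 N p) (scaled f N s)))
        \<longlonglongrightarrow> f (root 4 \<alpha>1 * fst p, root 4 \<alpha>2 * (r\<^sub>0 * fst p))"
      unfolding scaled_def Y1_def Y2_def
      by (intro tilted_mean_tendsto[OF f B] n1_top n2_top root_scaled_tanh_tendsto n1_ratio n2_ratio z_lim tendsto_const)
    from tendsto_mult[OF mixing_density_lim this]
    show "(\<lambda>N. integrand N (scaled f N) p) \<longlonglongrightarrow> v (fst p) * exp (- (h\<^sub>0 / 2) * (snd p)\<^sup>2)"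
      unfolding integrand_eq v_def by (simp only: mult_ac)
  qed
  then show ?thesis
    using pivot unfolding v_def[symmetric] by (simp only: integral_lborel_times[OF int_v int_g] diff_gt_0_iff_gt half_gt_zero)
qed

text \<open>The integrals for \<open>f\<close> and for the constant \<open>1\<close> share the
  Hubbard--Stratonovich factor at finite \<open>N\<close> and the Gaussian factor in the limit; both
  cancel.\<close>

theorem weighted_ratio_tendsto:
  fixes f :: "real \<times> real \<Rightarrow> real"
  assumes f: "continuous_on UNIV f" and B: "\<And>q. \<bar>f q\<bar> \<le> B"
  shows "(\<lambda>N. weighted_sum N (scaled f N) / weighted_sum N (\<lambda>_ _. 1)) \<longlonglongrightarrow>
    (\<integral>u. exp (- \<kappa> * u ^ 4) * f (root 4 \<alpha>1 * u, root 4 \<alpha>2 * r\<^sub>0 * u) \<partial>lborel) / (\<integral>u. exp (- \<kappa> * u ^ 4) \<partial>lborel)"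
proof -
  let ?I = "\<lambda>f N. \<integral>p. integrand N (scaled f N) p \<partial>lborel"
  let ?G = "\<integral>w. exp (- (h\<^sub>0 / 2) * w\<^sup>2) \<partial>lborel" and ?Z = "\<integral>u. exp (- \<kappa> * u ^ 4) \<partial>lborel"
  obtain \<eta> where \<eta>: "0 < \<eta>" and bound: "eventually (\<lambda>N. \<forall>p. mixing_density N p
      \<le> exp 1 * (exp (- \<eta> * (fst p)\<^sup>2) * exp (- \<eta> * (snd p)\<^sup>2))) sequentially"
    by (rule mixing_density_bound)
  have G: "0 < ?G"
    using gaussian_exp_integral[of "h\<^sub>0 / 2"] pivot by (simp add: has_bochner_integral_iff)
  have "?Z = Gamma (real (0 + 1) / 4) / (2 * \<kappa> powr (real (0 + 1) / 4))"
    using quartic_exponential_moment[OF \<kappa>_pos, of 0] by (simp add: has_bochner_integral_iff)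
  then have Z: "0 < ?Z" using \<kappa>_pos by (simp add: Gamma_real_pos)
  have lim1: "?I (\<lambda>_. 1) \<longlonglongrightarrow> ?Z * ?G"
    using integral_integrand_tendsto[of "\<lambda>_. 1" 1] by simp
  have "(\<lambda>N. ?I f N / ?I (\<lambda>_. 1) N) \<longlonglongrightarrow>
      (\<integral>u. exp (- \<kappa> * u ^ 4) * f (root 4 \<alpha>1 * u, root 4 \<alpha>2 * r\<^sub>0 * u) \<partial>lborel) * ?G / (?Z * ?G)"
    using G Z by (intro tendsto_divide lim1 integral_integrand_tendsto[OF f B]) auto
  \<comment> \<open>The integral for the constant \<open>1\<close> is eventually positive because
    its limit is; this keeps the common factor \<open>K\<close> from being \<open>0\<close>.\<close>
  moreover have "eventually (\<lambda>N. ?I f N / ?I (\<lambda>_. 1) N = weighted_sum N (scaled f N) / weighted_sum N (\<lambda>_ _. 1)) sequentially"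
    using bound eventually_gt_at_top[of 0] order_tendstoD(1)[OF lim1 mult_pos_pos[OF Z G]]
  proof eventually_elim
    case (elim N)
    have "integrable lborel (gauss N)"
    proof (rule Bochner_Integration.integrable_bound)
      show "integrable lborel (\<lambda>p. exp 1 * (exp (- \<eta> * (fst p)\<^sup>2) * exp (- \<eta> * (snd p)\<^sup>2)))"
        using gaussian_exp_integral[OF \<eta>]
        by (intro integrable_mult_right integrable_lborel_times) (auto simp: has_bochner_integral_iff)
      show "gauss N \<in> borel_measurable lborel"
        using continuous_gauss by (simp add: borel_measurable_continuous_onI)
      have "\<bar>gauss N p\<bar> \<le> exp 1 * (exp (- \<eta> * (fst p)\<^sup>2) * exp (- \<eta> * (snd p)\<^sup>2))" for p
      proof -
        have "\<bar>gauss N p\<bar> = gauss N p" by (simp add: gauss_def)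
        also have "\<dots> \<le> mixing_density N p" by (rule gauss_le_mixing_density)
        finally show ?thesis using elim(1)[rule_format, of p] by (rule order_trans)
      qed
      then show "AE p in lborel. norm (gauss N p) \<le> norm (exp 1 * (exp (- \<eta> * (fst p)\<^sup>2) * exp (- \<eta> * (snd p)\<^sup>2)))"
        by simp
    qed
    note I = integral_integrand[OF elim(2) this]
    define K where "K = (\<integral>p. gauss N p \<partial>lborel) / 2 ^ N"
    have "scaled (\<lambda>_. 1) N = (\<lambda>_ _. 1)" by (simp add: scaled_def fun_eq_iff)
    then have "K \<noteq> 0"
      using elim(3) I[of "scaled (\<lambda>_. 1) N"] unfolding K_def by auto
    then show ?case
      unfolding I K_def[symmetric] \<open>scaled (\<lambda>_. 1) N = _\<close> by simp
  qed
  ultimately have "(\<lambda>N. weighted_sum N (scaled f N) / weighted_sum N (\<lambda>_ _. 1)) \<longlonglongrightarrow>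
      (\<integral>u. exp (- \<kappa> * u ^ 4) * f (root 4 \<alpha>1 * u, root 4 \<alpha>2 * r\<^sub>0 * u) \<partial>lborel) * ?G / (?Z * ?G)"
    by (rule Lim_transform_eventually)
  then show ?thesis using G by simp
qed

end

section \<open>Reduction of the model and the limit measure\<close>

lemma sum_spin_configs:
  fixes n :: "2 \<Rightarrow> nat" and g :: "real \<Rightarrow> real \<Rightarrow> real"
  shows "(\<Sum>x\<in>spin_configs n. g (\<Sum>i=1..n 1. x 1 i) (\<Sum>i=1..n 2. x 2 i))
    = spin_sum (n 1) (\<lambda>s. spin_sum (n 2) (g s))"
proof -
  have two: "l = 1 \<or> l = 2" for l :: 2 by (rule exhaust_2)
  have "(\<Sum>x\<in>spin_configs n. g (\<Sum>i=1..n 1. x 1 i) (\<Sum>i=1..n 2. x 2 i))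
      = (\<Sum>p\<in>spin_vectors (n 1) \<times> spin_vectors (n 2). g (\<Sum>i=1..n 1. fst p i) (\<Sum>i=1..n 2. snd p i))"
  proof (rule sum.reindex_bij_witness[of _ "\<lambda>p l. if l = 1 then fst p else snd p" "\<lambda>x. (x 1, x 2)"])
    fix p assume "p \<in> spin_vectors (n 1) \<times> spin_vectors (n 2)"
    then have "(if l = 1 then fst p else snd p) \<in> spin_vectors (n l)" for l
      using two[of l] by auto
    then show "(\<lambda>l. if l = 1 then fst p else snd p) \<in> spin_configs n"
      by (auto simp: spin_configs_def spin_vectors_def)
  next
    fix x assume x: "x \<in> spin_configs n"
    show "(\<lambda>l. if l = 1 then fst (x 1, x 2) else snd (x 1, x 2)) = x"
      using two by fastforce
    show "(x 1, x 2) \<in> spin_vectors (n 1) \<times> spin_vectors (n 2)"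
      using x by (auto simp: spin_configs_def spin_vectors_def)
  qed auto
  then show ?thesis
    by (simp add: spin_sum_def sum.cartesian_product case_prod_unfold)
qed

lemma finite_spin_configs: "finite (spin_configs n)" for n :: "'g::finite \<Rightarrow> nat"
  unfolding spin_configs_def by (intro finite_PiE) auto

text \<open>Each sample point realises exactly one configuration, so the events \<open>E x\<close>
  partition the space and the expectation is a finite sum over them.\<close>

lemma curie_weiss_expectation:
  fixes J :: "real^'g^'g" and f :: "('g \<Rightarrow> real) \<Rightarrow> real"
  assumes cw: "curie_weiss J n M X"
  shows "(\<integral>\<omega>. f (\<lambda>l. group_sum n X l \<omega>) \<partial>M)
    = (\<Sum>x\<in>spin_configs n. cw_weight J n x * f (\<lambda>l. \<Sum>i=1..n l. x l i)) / cw_Z J n"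
proof -
  interpret prob_space M using cw by (simp add: curie_weiss_def)
  define E where "E x = {\<omega> \<in> space M. \<forall>l. \<forall>i\<in>{1..n l}. X l i \<omega> = x l i}" for x
  have X: "X l i \<in> borel_measurable M" "\<And>\<omega>. \<omega> \<in> space M \<Longrightarrow> X l i \<omega> \<in> {-1, 1}" if "i \<in> {1..n l}" for l i
    using cw that unfolding curie_weiss_def by blast+
  have meas: "E x \<in> sets M" for x
  proof -
    have "{\<omega> \<in> space M. \<forall>l\<in>UNIV. \<forall>i\<in>{1..n l}. X l i \<omega> = x l i} \<in> sets M"
      using X(1) by (intro sets.sets_Collect_finite_All borel_measurable_eq) auto
    then show ?thesis by (simp add: E_def)
  qed
  have prob: "measure M (E x) = cw_weight J n x / cw_Z J n" if "x \<in> spin_configs n" for x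
    using cw that unfolding curie_weiss_def E_def by blast
  have "f (\<lambda>l. group_sum n X l \<omega>) = (\<Sum>x\<in>spin_configs n. f (\<lambda>l. \<Sum>i=1..n l. x l i) * indicator (E x) \<omega>)"
    if \<omega>: "\<omega> \<in> space M" for \<omega>
  proof -
    \<comment> \<open>Values of \<open>X l i\<close> with \<open>i\<close> outside
      \<open>{1..n l}\<close> are arbitrary; the restriction makes \<open>y l\<close> extensional,
      as \<open>spin_configs\<close> demands.\<close>
    define y where "y l = restrict (\<lambda>i. X l i \<omega>) {1..n l}" for l
    have y: "y \<in> spin_configs n"
    proof -
      have "y l \<in> {1..n l} \<rightarrow>\<^sub>E {-1, 1}" for l
        unfolding y_def restrict_PiE_iff using X(2)[OF _ \<omega>] by blast
      then show ?thesis unfolding spin_configs_def PiE_UNIV_domain by blast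
    qed
    have eq: "\<omega> \<in> E x \<longleftrightarrow> x = y" if "x \<in> spin_configs n" for x
    proof
      assume "\<omega> \<in> E x"
      show "x = y"
      proof
        fix l
        show "x l = y l"
        proof (rule PiE_ext[of "x l" "{1..n l}" "\<lambda>_. {-1, 1}"])
          show "x l \<in> {1..n l} \<rightarrow>\<^sub>E {-1, 1}" "y l \<in> {1..n l} \<rightarrow>\<^sub>E {-1, 1}"
            using that y by (auto simp: spin_configs_def)
        qed (use \<open>\<omega> \<in> E x\<close> in \<open>auto simp: E_def y_def\<close>)
      qed
    next
      assume "x = y"
      then show "\<omega> \<in> E x" using \<omega> by (simp add: E_def y_def)
    qed
    have "(\<Sum>x\<in>spin_configs n. f (\<lambda>l. \<Sum>i=1..n l. x l i) * indicator (E x) \<omega>)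
        = (\<Sum>x\<in>spin_configs n. if x = y then f (\<lambda>l. \<Sum>i=1..n l. x l i) else 0)"
      by (intro sum.cong) (auto simp: eq indicator_def)
    also have "\<dots> = f (\<lambda>l. \<Sum>i=1..n l. y l i)"
      using y by (simp add: finite_spin_configs)
    also have "(\<lambda>l. \<Sum>i=1..n l. y l i) = (\<lambda>l. group_sum n X l \<omega>)"
      by (simp add: group_sum_def y_def)
    finally show ?thesis ..
  qed
  then have "(\<integral>\<omega>. f (\<lambda>l. group_sum n X l \<omega>) \<partial>M)
      = (\<integral>\<omega>. (\<Sum>x\<in>spin_configs n. f (\<lambda>l. \<Sum>i=1..n l. x l i) * indicator (E x) \<omega>) \<partial>M)"
    by (intro Bochner_Integration.integral_cong refl)
  also have "\<dots> = (\<Sum>x\<in>spin_configs n. f (\<lambda>l. \<Sum>i=1..n l. x l i) * measure M (E x))"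
    using meas by (subst Bochner_Integration.integral_sum) (auto simp: emeasure_eq_measure)
  also have "\<dots> = (\<Sum>x\<in>spin_configs n. cw_weight J n x * f (\<lambda>l. \<Sum>i=1..n l. x l i) / cw_Z J n)"
    by (intro sum.cong) (auto simp: prob)
  finally show ?thesis by (simp add: sum_divide_distrib)
qed

text \<open>The weight depends on a configuration only through its two group sums. The factor
  \<open>1\<close> in the normalising sum gives it the shape of \<open>weighted_sum\<close> at the
  constant function.\<close>

lemma two_group_expectation:
  fixes J :: "real^2^2"
  assumes cw: "curie_weiss J n M X" and sym: "J $ 2 $ 1 = J $ 1 $ 2"
  defines "W s t \<equiv> exp ((J $ 1 $ 1 * s\<^sup>2 + 2 * (J $ 1 $ 2) * s * t + J $ 2 $ 2 * t\<^sup>2) / (2 * real (n 1 + n 2)))"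
  shows "(\<integral>\<omega>. g (group_sum n X 1 \<omega>) (group_sum n X 2 \<omega>) \<partial>M)
    = spin_sum (n 1) (\<lambda>s. spin_sum (n 2) (\<lambda>t. W s t * g s t)) / spin_sum (n 1) (\<lambda>s. spin_sum (n 2) (\<lambda>t. W s t * 1))"
proof -
  have weight: "cw_weight J n x = W (\<Sum>i=1..n 1. x 1 i) (\<Sum>i=1..n 2. x 2 i)" for x
    unfolding cw_weight_def W_def
    by (simp add: sum_2 sum_product[symmetric] sym power2_eq_square algebra_simps add_divide_distrib)
  show ?thesis
    using curie_weiss_expectation[OF cw, of "\<lambda>S. g (S 1) (S 2)"]
      sum_spin_configs[where n = n and g = "\<lambda>s t. W s t * g s t"] sum_spin_configs[where n = n and g = W]
    unfolding cw_Z_def weight by simp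
qed

section \<open>The limit measure and its moments\<close>

text \<open>The measure is the image of the law with density proportional to
  \<open>exp (- \<kappa> * u ^ 4)\<close> under the map sending \<open>u\<close> to
  \<open>(A * u, B * u)\<close>, so mixed moments reduce to moments of \<open>u\<close> of order
  \<open>K + Q\<close>.\<close>

lemma quartic_limit_measure:
  fixes \<kappa> A B :: real
  assumes \<kappa>: "0 < \<kappa>"
  obtains \<mu> :: "(real \<times> real) measure" where "prob_space \<mu>" "sets \<mu> = sets borel"
    "\<And>f :: real \<times> real \<Rightarrow> real. f \<in> borel_measurable borel \<Longrightarrow>
      (\<integral>p. f p \<partial>\<mu>) = (\<integral>u. exp (- \<kappa> * u ^ 4) * f (A * u, B * u) \<partial>lborel) / (\<integral>u. exp (- \<kappa> * u ^ 4) \<partial>lborel)"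
    "\<And>K Q. integrable \<mu> (\<lambda>p. fst p ^ K * snd p ^ Q)"
    "\<And>K Q. moment K Q \<mu> = (if even (K + Q) then A ^ K * B ^ Q * (1 / \<kappa>) powr (real (K + Q) / 4) *
      (Gamma (real (K + Q + 1) / 4) / Gamma (1 / 4)) else 0)"
proof -
  define Z where "Z = (\<integral>u. exp (- \<kappa> * u ^ 4) \<partial>lborel)"
  have mom: "has_bochner_integral lborel (\<lambda>u. exp (- \<kappa> * u ^ 4) * u ^ m)
    (if even m then Gamma (real (m + 1) / 4) / (2 * \<kappa> powr (real (m + 1) / 4)) else 0)" for m
    using quartic_exponential_moment[OF \<kappa>, of m] by (simp only: mult.commute)
  have Z_eq: "Z = Gamma (1 / 4) / (2 * \<kappa> powr (1 / 4))"
    using mom[of 0] by (simp add: Z_def has_bochner_integral_iff)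
  have Z: "0 < Z"
    unfolding Z_eq using \<kappa> by (simp add: Gamma_real_pos)
  define D where "D u = exp (- \<kappa> * u ^ 4) / Z" for u
  have D: "\<And>u. 0 \<le> D u" "D \<in> borel_measurable borel"
    using Z by (auto simp: D_def[abs_def])
  define \<nu> where "\<nu> = density lborel D"
  define \<phi> where "\<phi> u = (A * u, B * u)" for u
  have \<phi>: "\<phi> \<in> \<nu> \<rightarrow>\<^sub>M borel"
    unfolding \<phi>_def[abs_def] \<nu>_def by (simp add: borel_measurable_continuous_onI continuous_intros)
  define \<mu> where "\<mu> = distr \<nu> borel \<phi>"
  have int_D: "has_bochner_integral lborel (\<lambda>u. D u * u ^ m)
      ((if even m then Gamma (real (m + 1) / 4) / (2 * \<kappa> powr (real (m + 1) / 4)) else 0) / Z)" for m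
    using has_bochner_integral_divide_zero[OF mom[of m], of Z] by (simp add: D_def)
  have "integral\<^sup>N lborel D = 1"
    using int_D[of 0] D Z
    by (subst nn_integral_eq_integral) (auto simp: has_bochner_integral_iff Z_eq[symmetric])
  then have "prob_space \<nu>"
    using D by (intro prob_spaceI) (simp add: \<nu>_def emeasure_density)
  then interpret \<nu>: prob_space \<nu> .
  have int: "(\<integral>p. f p \<partial>\<mu>) = (\<integral>u. D u * f (\<phi> u) \<partial>lborel)"
    and integrable: "integrable \<mu> f \<longleftrightarrow> integrable lborel (\<lambda>u. D u * f (\<phi> u))"
    if f: "f \<in> borel_measurable borel" for f :: "real \<times> real \<Rightarrow> real"
  proof -
    have "\<phi> \<in> lborel \<rightarrow>\<^sub>M borel" using \<phi> by (simp add: \<nu>_def)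
    with f have f\<phi>: "(\<lambda>u. f (\<phi> u)) \<in> borel_measurable lborel" by measurable
    show "(\<integral>p. f p \<partial>\<mu>) = (\<integral>u. D u * f (\<phi> u) \<partial>lborel)"
      unfolding \<mu>_def integral_distr[OF \<phi> f] unfolding \<nu>_def
      using D f\<phi> by (subst integral_density) auto
    show "integrable \<mu> f \<longleftrightarrow> integrable lborel (\<lambda>u. D u * f (\<phi> u))"
      unfolding \<mu>_def integrable_distr_eq[OF \<phi> f] unfolding \<nu>_def
      using D f\<phi> by (subst integrable_density) auto
  qed
  have mono: "(\<lambda>p::real \<times> real. fst p ^ K * snd p ^ Q) \<in> borel_measurable borel" for K Q
    by (intro borel_measurable_continuous_onI continuous_intros)
  have mono_\<phi>: "D u * (fst (\<phi> u) ^ K * snd (\<phi> u) ^ Q) = A ^ K * B ^ Q * (D u * u ^ (K + Q))" for u K Q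
    by (simp add: \<phi>_def power_mult_distrib power_add)
  show thesis
  proof (rule that)
    show "prob_space \<mu>" unfolding \<mu>_def by (rule \<nu>.prob_space_distr[OF \<phi>])
    show "sets \<mu> = sets borel" by (simp add: \<mu>_def)
    show "(\<integral>p. f p \<partial>\<mu>) = (\<integral>u. exp (- \<kappa> * u ^ 4) * f (A * u, B * u) \<partial>lborel) / (\<integral>u. exp (- \<kappa> * u ^ 4) \<partial>lborel)"
      if "f \<in> borel_measurable borel" for f :: "real \<times> real \<Rightarrow> real"
      unfolding int[OF that] D_def \<phi>_def Z_def[symmetric] by simp
    fix K Q
    show "integrable \<mu> (\<lambda>p. fst p ^ K * snd p ^ Q)"
      unfolding integrable[OF mono] mono_\<phi>
      using int_D[of "K + Q"] by (intro integrable_mult_right) (simp only: has_bochner_integral_iff)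
    have "moment K Q \<mu> = A ^ K * B ^ Q * (\<integral>u. D u * u ^ (K + Q) \<partial>lborel)"
      unfolding moment_def int[OF mono] mono_\<phi> by simp
    also have "(\<integral>u. D u * u ^ (K + Q) \<partial>lborel)
        = (if even (K + Q) then Gamma (real (K + Q + 1) / 4) / (2 * \<kappa> powr (real (K + Q + 1) / 4)) else 0) / Z"
      using int_D[of "K + Q"] by (simp only: has_bochner_integral_iff)
    also have "\<dots> = (if even (K + Q) then (1 / \<kappa>) powr (real (K + Q) / 4) *
        (Gamma (real (K + Q + 1) / 4) / Gamma (1 / 4)) else 0)"
    proof -
      \<comment> \<open>The factor \<open>\<kappa> powr (1 / 4)\<close> cancels against the one in
        \<open>Z_eq\<close>.\<close>
      have "\<kappa> powr (real (K + Q + 1) / 4) = \<kappa> powr (real (K + Q) / 4) * \<kappa> powr (1 / 4)"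
        unfolding powr_add[symmetric] by (rule arg_cong[of _ _ "(powr) \<kappa>"]) (simp add: field_simps)
      moreover have "(1 / \<kappa>) powr (real (K + Q) / 4) = 1 / \<kappa> powr (real (K + Q) / 4)"
        using \<kappa> by (simp add: powr_divide)
      ultimately show ?thesis
        using \<kappa> by (simp add: Z_eq)
    qed
    finally show "moment K Q \<mu> = (if even (K + Q) then A ^ K * B ^ Q * (1 / \<kappa>) powr (real (K + Q) / 4) *
      (Gamma (real (K + Q + 1) / 4) / Gamma (1 / 4)) else 0)"
      by simp
  qed
qed

text \<open>If \<open>b < 0\<close>, then \<open>\<alpha>1\<close> or \<open>\<alpha>2\<close> vanishes, so both sides are \<open>0\<close> unless \<open>Q\<close> is even: the sign of \<open>b\<close> is lost.\<close>

lemma critical_constant: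
  fixes \<alpha>1 \<alpha>2 h1 h2 b :: real
  assumes \<alpha>: "0 \<le> \<alpha>1" "0 \<le> \<alpha>2" and h: "0 \<le> h1" "0 < h2" and b: "b\<^sup>2 = h1 * h2"
    and sgn: "0 < \<alpha>1 \<Longrightarrow> 0 < \<alpha>2 \<Longrightarrow> 0 \<le> b" and even: "even (K + Q)"
  shows "root 4 \<alpha>1 ^ K * (root 4 \<alpha>2 * (b / h2)) ^ Q * (1 / ((\<alpha>1 + \<alpha>2 * (b / h2) ^ 4) / 12)) powr (real (K + Q) / 4)
    = (12 / (\<alpha>1 * h2\<^sup>2 + \<alpha>2 * h1\<^sup>2)) powr (real (K + Q) / 4) * sqrt h1 ^ Q * sqrt h2 ^ K * root 4 \<alpha>1 ^ K * root 4 \<alpha>2 ^ Q"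
proof -
  let ?d = "\<alpha>1 * h2\<^sup>2 + \<alpha>2 * h1\<^sup>2"
  have sq: "sqrt h2 ^ 2 = h2" "sqrt h2 \<noteq> 0" using h by simp_all
  have "(b / h2) ^ 4 = ((b / h2)\<^sup>2)\<^sup>2" by simp
  also have "\<dots> = h1\<^sup>2 / h2\<^sup>2"
    using h by (simp only: power_divide b) (simp add: field_simps power2_eq_square)
  finally have r4: "(b / h2) ^ 4 = h1\<^sup>2 / h2\<^sup>2" .
  have "1 / ((\<alpha>1 + \<alpha>2 * (b / h2) ^ 4) / 12) = 12 / ?d * h2\<^sup>2"
    unfolding r4 using h by (simp add: field_simps)
  also have "(12 / ?d * h2\<^sup>2) powr (real (K + Q) / 4) = (12 / ?d) powr (real (K + Q) / 4) * (h2\<^sup>2) powr (real (K + Q) / 4)"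
    by (rule powr_mult)
  also have "(h2\<^sup>2) powr (real (K + Q) / 4) = sqrt h2 ^ (K + Q)"
  proof -
    have "(h2\<^sup>2) powr (real (K + Q) / 4) = (h2 powr 2) powr (real (K + Q) / 4)"
      using h by (simp add: powr_numeral)
    also have "\<dots> = (h2 powr (1/2)) powr real (K + Q)"
      unfolding powr_powr by (rule arg_cong[of _ _ "(powr) h2"]) simp
    also have "\<dots> = sqrt h2 ^ (K + Q)"
      using h by (simp only: powr_half_sqrt powr_realpow real_sqrt_gt_zero less_imp_le)
    finally show ?thesis .
  qed
  finally have pow: "(1 / ((\<alpha>1 + \<alpha>2 * (b / h2) ^ 4) / 12)) powr (real (K + Q) / 4)
      = (12 / ?d) powr (real (K + Q) / 4) * sqrt h2 ^ (K + Q)" .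
  have "root 4 \<alpha>1 ^ K * root 4 \<alpha>2 ^ Q * (b / sqrt h2) ^ Q = root 4 \<alpha>1 ^ K * root 4 \<alpha>2 ^ Q * sqrt h1 ^ Q"
  proof -
    have abs_b: "\<bar>b\<bar> / sqrt h2 = sqrt h1"
    proof -
      have "\<bar>b\<bar> = sqrt h1 * sqrt h2"
        using b by (metis real_sqrt_abs real_sqrt_mult)
      then show ?thesis using sq(2) by simp
    qed
    \<comment> \<open>If \<open>b < 0\<close>, one of the proportions is \<open>0\<close>. Either
      its root occurs with a positive exponent and both sides vanish, or \<open>K = 0\<close> or
      \<open>Q = 0\<close>, and then \<open>Q\<close> is even because \<open>K + Q\<close>
      is.\<close>
    consider "0 \<le> b" | "\<alpha>1 = 0" "0 < K" | "\<alpha>2 = 0" "0 < Q" | "even Q" | "Q = 0"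
      using sgn \<alpha> even by (metis even_add gr0I less_eq_real_def dvd_0_right)
    then show ?thesis
    proof cases
      case 1
      then show ?thesis using abs_b by simp
    next
      case 4
      then have "(b / sqrt h2) ^ Q = (\<bar>b\<bar> / sqrt h2) ^ Q"
        by (simp add: power_divide power_even_abs)
      then show ?thesis using abs_b by simp
    qed simp_all
  qed
  note roots = this
  have shift: "(b / h2) ^ Q * sqrt h2 ^ (K + Q) = (b / sqrt h2) ^ Q * sqrt h2 ^ K"
  proof -
    have "b / h2 * sqrt h2 = b / sqrt h2"
      using sq h by (simp add: field_simps power2_eq_square)
    then have "(b / h2) ^ Q * sqrt h2 ^ Q = (b / sqrt h2) ^ Q"
      by (metis power_mult_distrib)
    then show ?thesis by (simp add: power_add mult_ac)
  qed
  let ?p = "(12 / ?d) powr (real (K + Q) / 4)"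
  have "root 4 \<alpha>1 ^ K * (root 4 \<alpha>2 * (b / h2)) ^ Q * (?p * sqrt h2 ^ (K + Q))
      = ?p * (root 4 \<alpha>1 ^ K * root 4 \<alpha>2 ^ Q) * ((b / h2) ^ Q * sqrt h2 ^ (K + Q))"
    unfolding power_mult_distrib by (simp only: mult_ac)
  also have "\<dots> = ?p * (root 4 \<alpha>1 ^ K * root 4 \<alpha>2 ^ Q * (b / sqrt h2) ^ Q) * sqrt h2 ^ K"
    unfolding shift by (simp only: mult_ac)
  also have "\<dots> = ?p * sqrt h1 ^ Q * sqrt h2 ^ K * root 4 \<alpha>1 ^ K * root 4 \<alpha>2 ^ Q"
    unfolding roots by (simp only: mult_ac)
  finally show ?thesis unfolding pow .
qed

text \<open>The square roots in \<open>critical_moment\<close> retain only the absolute value of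
  \<open>Lbar\<close>, hence \<open>sign_convention\<close>. As \<open>cw_H J \<alpha>\<close> is
  singular, \<open>denominator\<close> excludes exactly the case that it is the zero matrix, where
  neither coordinate could serve as pivot.\<close>

theorem theorem16:
  fixes J :: "real^2^2" and \<alpha> :: "real^2" and L1 L2 Lbar :: real
    and n :: "nat \<Rightarrow> 2 \<Rightarrow> nat"
    and M :: "nat \<Rightarrow> 'a measure" and X :: "nat \<Rightarrow> 2 \<Rightarrow> nat \<Rightarrow> 'a \<Rightarrow> real"
  assumes sizes: "\<And>N. n N 1 + n N 2 = N"
    and sizes_infinity: "\<And>l. filterlim (\<lambda>N. n N l) at_top sequentially"
    and proportions: "\<And>l. (\<lambda>N. real (n N l) / real N) \<longlonglongrightarrow> \<alpha> $ l"
    and alpha_nonneg: "\<And>l. \<alpha> $ l \<ge> 0"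
    and alpha_sum: "\<alpha> $ 1 + \<alpha> $ 2 = 1"
    and heterogeneous: "pos_def J"
    and critical: "critical_regime J \<alpha>"
    and J_inverse: "matrix_inv J = vector [vector [L1, - Lbar], vector [- Lbar, L2]]"
    and model: "\<And>N. curie_weiss J (n N) (M N) (X N)"
    and sign_convention: "\<alpha> $ 1 > 0 \<Longrightarrow> \<alpha> $ 2 > 0 \<Longrightarrow> Lbar \<ge> 0"
    and denominator: "\<alpha> $ 1 * (L2 - \<alpha> $ 2)\<^sup>2 + \<alpha> $ 2 * (L1 - \<alpha> $ 1)\<^sup>2 \<noteq> 0"
    and finite_size_criticality:
      "(\<lambda>N. sqrt (real N) * det (cw_H J (\<chi> l. real (n N l) / real N))) \<longlonglongrightarrow> 0"
  shows "\<exists>\<mu> :: (real \<times> real) measure.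
    prob_space \<mu> \<and> sets \<mu> = sets borel \<and>
    weakly_converges
      (\<lambda>N. distr (M N) borel
        (\<lambda>\<omega>. (group_sum (n N) (X N) 1 \<omega> / real (n N 1) powr (3/4),
              group_sum (n N) (X N) 2 \<omega> / real (n N 2) powr (3/4)))) \<mu> \<and>
    (\<forall>K Q. integrable \<mu> (\<lambda>p. fst p ^ K * snd p ^ Q) \<and>
           moment K Q \<mu> = critical_moment \<alpha> L1 L2 K Q)"
proof -
  define \<alpha>1 \<alpha>2 where "\<alpha>1 = \<alpha> $ 1" and "\<alpha>2 = \<alpha> $ 2"
  define h1 h2 where "h1 = L1 - \<alpha>1" and "h2 = L2 - \<alpha>2"
  let ?n1 = "\<lambda>N. n N 1" and ?n2 = "\<lambda>N. n N 2"
  have \<alpha>: "0 \<le> \<alpha>1" "0 \<le> \<alpha>2" using alpha_nonneg by (simp_all add: \<alpha>1_def \<alpha>2_def)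

  have sym: "J $ 2 $ 1 = J $ 1 $ 2"
  proof -
    have "transpose J = J" using heterogeneous by (simp add: pos_def_def)
    from arg_cong[OF this, of "\<lambda>A. A $ 1 $ 2"] show ?thesis by (simp add: transpose_def)
  qed
  have "x = 0" if "J *v x = 0" for x
    using heterogeneous that unfolding pos_def_def by (metis inner_zero_right less_irrefl)
  then have "invertible J"
    by (auto simp: invertible_left_inverse matrix_left_invertible_ker)
  then have J_inv: "J ** matrix_inv J = mat 1"
    unfolding invertible_def matrix_inv_def by (rule someI2_ex) simp
  have inverse: "J $ 1 $ 1 * L1 - J $ 1 $ 2 * Lbar = 1" "J $ 1 $ 2 * L2 - J $ 1 $ 1 * Lbar = 0"
    "J $ 1 $ 2 * L1 - J $ 2 $ 2 * Lbar = 0" "J $ 2 $ 2 * L2 - J $ 1 $ 2 * Lbar = 1"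
  proof -
    have "(\<Sum>k\<in>UNIV. J $ i $ k * matrix_inv J $ k $ j) = (if i = j then 1 else 0)" for i j
      using arg_cong[OF J_inv, of "\<lambda>A. A $ i $ j"] by (simp add: matrix_matrix_mult_def mat_def)
    note entry = this[unfolded J_inverse sum_2 vector_2]
    from entry[of 1 1] entry[of 1 2] entry[of 2 1] entry[of 2 2] sym
    show "J $ 1 $ 1 * L1 - J $ 1 $ 2 * Lbar = 1" "J $ 1 $ 2 * L2 - J $ 1 $ 1 * Lbar = 0"
      "J $ 1 $ 2 * L1 - J $ 2 $ 2 * Lbar = 0" "J $ 2 $ 2 * L2 - J $ 1 $ 2 * Lbar = 1"
      by simp_all
  qed

  have H: "cw_H J v $ 1 $ 1 = L1 - v $ 1" "cw_H J v $ 2 $ 2 = L2 - v $ 2"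
    "cw_H J v $ 1 $ 2 = - Lbar" "cw_H J v $ 2 $ 1 = - Lbar" for v
    by (simp_all add: cw_H_def J_inverse diag_matrix_def)
  have det_H: "det (cw_H J v) = (L1 - v $ 1) * (L2 - v $ 2) - Lbar\<^sup>2" for v
    by (simp add: det_2 H power2_eq_square)
  have "0 \<le> cw_H J \<alpha> $ i $ i" for i
  proof -
    have "axis i 1 \<bullet> (cw_H J \<alpha> *v axis i 1) = cw_H J \<alpha> $ i $ i"
      by (simp add: matrix_vector_mult_basis inner_axis' column_def)
    then show ?thesis
      using critical unfolding critical_regime_def pos_semidef_def by metis
  qed
  from this[of 1] this[of 2] have h: "0 \<le> h1" "0 \<le> h2"
    by (simp_all add: H h1_def h2_def \<alpha>1_def \<alpha>2_def)
  have det_small: "(\<lambda>N. sqrt (real N) * ((L1 - real (n N 1) / real N) * (L2 - real (n N 2) / real N) - Lbar\<^sup>2)) \<longlonglongrightarrow> 0"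
    using finite_size_criticality by (simp add: det_H)
  \<comment> \<open>The determinant at the limiting proportions is the limit of the finite-size
    determinants, and these tend to \<open>0\<close> even after multiplication by
    \<open>sqrt N\<close>.\<close>
  have Lbar: "Lbar\<^sup>2 = h1 * h2"
  proof -
    let ?D = "\<lambda>N. (L1 - real (n N 1) / real N) * (L2 - real (n N 2) / real N) - Lbar\<^sup>2"
    have "?D \<longlonglongrightarrow> h1 * h2 - Lbar\<^sup>2"
      unfolding h1_def h2_def \<alpha>1_def \<alpha>2_def by (intro tendsto_intros proportions)
    moreover have "?D \<longlonglongrightarrow> 0"
    proof (rule Lim_transform_eventually)
      show "(\<lambda>N. (sqrt (real N) * ?D N) / sqrt (real N)) \<longlonglongrightarrow> 0"
        by (intro real_tendsto_divide_at_top[OF det_small] filterlim_compose[OF sqrt_at_top filterlim_real_sequentially])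
      show "eventually (\<lambda>N. (sqrt (real N) * ?D N) / sqrt (real N) = ?D N) sequentially"
        using eventually_gt_at_top[of 0] by eventually_elim simp
    qed
    ultimately show ?thesis using LIMSEQ_unique by fastforce
  qed

  define E where "E f N = (\<integral>\<omega>. f (group_sum (n N) (X N) 1 \<omega> / real (n N 1) powr (3/4),
      group_sum (n N) (X N) 2 \<omega> / real (n N 2) powr (3/4)) \<partial>M N)" for f :: "real \<times> real \<Rightarrow> real" and N
  \<comment> \<open>Both choices of the pivot are brought to one form: a quartic law on the line
    through \<open>(A, B)\<close>, together with the match of its constants with those of
    \<open>critical_moment\<close>.\<close>
  have "\<exists>A B \<kappa>. 0 < \<kappa> \<and>
      (\<forall>f. continuous_on UNIV f \<and> bounded (range f) \<longrightarrow>
        E f \<longlonglongrightarrow> (\<integral>u. exp (- \<kappa> * u ^ 4) * f (A * u, B * u) \<partial>lborel) / (\<integral>u. exp (- \<kappa> * u ^ 4) \<partial>lborel)) \<and>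
      (\<forall>K Q. even (K + Q) \<longrightarrow> A ^ K * B ^ Q * (1 / \<kappa>) powr (real (K + Q) / 4)
        = (12 / (\<alpha>1 * h2\<^sup>2 + \<alpha>2 * h1\<^sup>2)) powr (real (K + Q) / 4) * sqrt h1 ^ Q * sqrt h2 ^ K * root 4 \<alpha>1 ^ K * root 4 \<alpha>2 ^ Q)"
  proof (cases "0 < h2")
    case True
    interpret G: critical_two_groups ?n1 ?n2 L1 L2 Lbar "J $ 1 $ 1" "J $ 1 $ 2" "J $ 2 $ 2" \<alpha>1 \<alpha>2
    proof
      show "0 < \<alpha>1 + \<alpha>2 * (Lbar / (L2 - \<alpha>2))\<^sup>2"
      proof -
        have "(Lbar / h2)\<^sup>2 = h1 / h2"
          using True by (simp add: power_divide Lbar) (simp add: power2_eq_square)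
        \<comment> \<open>A vanishing sum would force \<open>\<alpha>1 = 0\<close> and
          \<open>\<alpha>2 * h1 = 0\<close>, and with them the denominator would vanish.\<close>
        moreover have "\<alpha>1 + \<alpha>2 * (h1 / h2) \<noteq> 0"
        proof
          assume "\<alpha>1 + \<alpha>2 * (h1 / h2) = 0"
          moreover have "0 \<le> \<alpha>2 * (h1 / h2)" using \<alpha> h by simp
          ultimately have "\<alpha>1 = 0" "\<alpha>2 * (h1 / h2) = 0" using \<alpha> by linarith+
          then show False using denominator True by (auto simp: \<alpha>1_def[symmetric] \<alpha>2_def[symmetric] h1_def h2_def)
        qed
        moreover have "0 \<le> \<alpha>1 + \<alpha>2 * (h1 / h2)" using \<alpha> h by simp
        ultimately show ?thesis by (simp add: h2_def)
      qed
    qed (use sizes sizes_infinity proportions \<alpha> inverse det_small True in \<open>auto simp: \<alpha>1_def \<alpha>2_def h2_def\<close>)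
    have "E f \<longlonglongrightarrow> (\<integral>u. exp (- G.\<kappa> * u ^ 4) * f (root 4 \<alpha>1 * u, root 4 \<alpha>2 * (Lbar / h2) * u) \<partial>lborel)
        / (\<integral>u. exp (- G.\<kappa> * u ^ 4) \<partial>lborel)" if f: "continuous_on UNIV f" "bounded (range f)" for f
    proof -
      obtain B where B: "\<And>q. \<bar>f q\<bar> \<le> B" using f(2) by (auto simp: bounded_iff)
      have E: "E f N = G.weighted_sum N (G.scaled f N) / G.weighted_sum N (\<lambda>_ _. 1)" for N
        unfolding E_def G.weighted_sum_def G.weight_def G.scaled_def
        using two_group_expectation[OF model[of N] sym, of "\<lambda>s t. f (s / real (n N 1) powr (3/4), t / real (n N 2) powr (3/4))"]
        unfolding sizes by simp
      show ?thesis
        unfolding ext[of "E f", OF E] h2_def by (rule G.weighted_ratio_tendsto[OF f(1) B])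
    qed
    moreover have "root 4 \<alpha>1 ^ K * (root 4 \<alpha>2 * (Lbar / h2)) ^ Q * (1 / G.\<kappa>) powr (real (K + Q) / 4)
        = (12 / (\<alpha>1 * h2\<^sup>2 + \<alpha>2 * h1\<^sup>2)) powr (real (K + Q) / 4) * sqrt h1 ^ Q * sqrt h2 ^ K * root 4 \<alpha>1 ^ K * root 4 \<alpha>2 ^ Q"
      if "even (K + Q)" for K Q
      unfolding G.\<kappa>_def h2_def[symmetric]
      using critical_constant[OF \<alpha> h(1) True Lbar _ that] sign_convention by (simp only: \<alpha>1_def \<alpha>2_def)
    ultimately show ?thesis using G.\<kappa>_pos by blast
  next
    case False
    \<comment> \<open>With \<open>h2 = 0\<close> the coupling \<open>Lbar\<close> vanishes too, and
      the nonzero denominator leaves \<open>h1\<close> as pivot. The groups are exchanged, and the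
      first coordinate of the limit is degenerate at \<open>0\<close>.\<close>
    then have h20: "h2 = 0" using h by simp
    then have Lbar0: "Lbar = 0" using Lbar by simp
    have "\<alpha>2 * h1\<^sup>2 \<noteq> 0"
      using denominator h20 by (simp add: \<alpha>1_def[symmetric] \<alpha>2_def[symmetric] h1_def h2_def)
    then have pos: "0 < h1" "0 < \<alpha>2" using h \<alpha> by (auto simp: less_le)
    interpret G: critical_two_groups ?n2 ?n1 L2 L1 Lbar "J $ 2 $ 2" "J $ 1 $ 2" "J $ 1 $ 1" \<alpha>2 \<alpha>1
      using sizes sizes_infinity proportions \<alpha> inverse det_small pos
      by unfold_locales (auto simp: \<alpha>1_def \<alpha>2_def h1_def Lbar0 mult.commute add.commute)
    have "E f \<longlonglongrightarrow> (\<integral>u. exp (- G.\<kappa> * u ^ 4) * f (root 4 \<alpha>1 * (Lbar / h1) * u, root 4 \<alpha>2 * u) \<partial>lborel)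
        / (\<integral>u. exp (- G.\<kappa> * u ^ 4) \<partial>lborel)" if f: "continuous_on UNIV f" "bounded (range f)" for f
    proof -
      define g where "g p = f (snd p, fst p)" for p
      have g: "continuous_on UNIV g"
        unfolding g_def by (intro continuous_on_compose2[OF f(1)] continuous_intros) auto
      obtain B where "\<And>q. \<bar>f q\<bar> \<le> B" using f(2) by (auto simp: bounded_iff)
      then have B: "\<And>q. \<bar>g q\<bar> \<le> B" by (simp add: g_def)
      have E: "E f N = G.weighted_sum N (G.scaled g N) / G.weighted_sum N (\<lambda>_ _. 1)" for N
        unfolding E_def G.weighted_sum_def G.weight_def G.scaled_def g_def
        using two_group_expectation[OF model[of N] sym, of "\<lambda>s t. f (s / real (n N 1) powr (3/4), t / real (n N 2) powr (3/4))"]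
        unfolding sizes spin_sum_swap[of "n N 1"] by (simp add: algebra_simps)
      have "E f \<longlonglongrightarrow> (\<integral>u. exp (- G.\<kappa> * u ^ 4) * g (root 4 \<alpha>2 * u, root 4 \<alpha>1 * (Lbar / (L1 - \<alpha>1)) * u) \<partial>lborel)
        / (\<integral>u. exp (- G.\<kappa> * u ^ 4) \<partial>lborel)"
        unfolding ext[of "E f", OF E] by (rule G.weighted_ratio_tendsto[OF g B])
      then show ?thesis by (simp add: g_def h1_def)
    qed
    moreover have "(root 4 \<alpha>1 * (Lbar / h1)) ^ K * root 4 \<alpha>2 ^ Q * (1 / G.\<kappa>) powr (real (K + Q) / 4)
        = (12 / (\<alpha>1 * h2\<^sup>2 + \<alpha>2 * h1\<^sup>2)) powr (real (K + Q) / 4) * sqrt h1 ^ Q * sqrt h2 ^ K * root 4 \<alpha>1 ^ K * root 4 \<alpha>2 ^ Q"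
      if "even (K + Q)" for K Q
      using critical_constant[OF \<alpha>(2,1) h(2) pos(1), of Lbar Q K] that Lbar0 h20
      unfolding G.\<kappa>_def h1_def[symmetric] by (simp add: add.commute mult_ac)
    ultimately show ?thesis using G.\<kappa>_pos by blast
  qed
  then obtain A B \<kappa> where \<kappa>: "0 < \<kappa>"
    and lim: "\<And>f. continuous_on UNIV f \<Longrightarrow> bounded (range f) \<Longrightarrow>
        E f \<longlonglongrightarrow> (\<integral>u. exp (- \<kappa> * u ^ 4) * f (A * u, B * u) \<partial>lborel) / (\<integral>u. exp (- \<kappa> * u ^ 4) \<partial>lborel)"
    and const: "\<And>K Q. even (K + Q) \<Longrightarrow> A ^ K * B ^ Q * (1 / \<kappa>) powr (real (K + Q) / 4)
        = (12 / (\<alpha>1 * h2\<^sup>2 + \<alpha>2 * h1\<^sup>2)) powr (real (K + Q) / 4) * sqrt h1 ^ Q * sqrt h2 ^ K * root 4 \<alpha>1 ^ K * root 4 \<alpha>2 ^ Q"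
    by blast
  obtain \<mu> :: "(real \<times> real) measure" where \<mu>: "prob_space \<mu>" "sets \<mu> = sets borel"
    and \<mu>_int: "\<And>f :: real \<times> real \<Rightarrow> real. f \<in> borel_measurable borel \<Longrightarrow>
      (\<integral>p. f p \<partial>\<mu>) = (\<integral>u. exp (- \<kappa> * u ^ 4) * f (A * u, B * u) \<partial>lborel) / (\<integral>u. exp (- \<kappa> * u ^ 4) \<partial>lborel)"
    and \<mu>_integrable: "\<And>K Q. integrable \<mu> (\<lambda>p. fst p ^ K * snd p ^ Q)"
    and \<mu>_moment: "\<And>K Q. moment K Q \<mu> = (if even (K + Q) then A ^ K * B ^ Q * (1 / \<kappa>) powr (real (K + Q) / 4) *
      (Gamma (real (K + Q + 1) / 4) / Gamma (1 / 4)) else 0)"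
    using quartic_limit_measure[OF \<kappa>] by blast
  have "weakly_converges
      (\<lambda>N. distr (M N) borel
        (\<lambda>\<omega>. (group_sum (n N) (X N) 1 \<omega> / real (n N 1) powr (3/4),
              group_sum (n N) (X N) 2 \<omega> / real (n N 2) powr (3/4)))) \<mu>"
    unfolding weakly_converges_def
  proof (intro allI impI, elim conjE)
    fix f :: "real \<times> real \<Rightarrow> real"
    assume f: "continuous_on UNIV f" "bounded (range f)"
    have fm: "f \<in> borel_measurable borel" using f(1) by (rule borel_measurable_continuous_onI)
    have "group_sum (n N) (X N) l \<in> borel_measurable (M N)" for N l
    proof -
      have "X N l i \<in> borel_measurable (M N)" if "i \<in> {1..n N l}" for i
        using model[of N] that unfolding curie_weiss_def by blast
      then show ?thesis
        unfolding group_sum_def[abs_def] by (rule borel_measurable_sum)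
    qed
    then have "(\<integral>p. f p \<partial>distr (M N) borel
        (\<lambda>\<omega>. (group_sum (n N) (X N) 1 \<omega> / real (n N 1) powr (3/4),
              group_sum (n N) (X N) 2 \<omega> / real (n N 2) powr (3/4)))) = E f N" for N
      unfolding E_def by (intro integral_distr fm borel_measurable_Pair borel_measurable_divide borel_measurable_const)
    then show "(\<lambda>N. \<integral>p. f p \<partial>distr (M N) borel
        (\<lambda>\<omega>. (group_sum (n N) (X N) 1 \<omega> / real (n N 1) powr (3/4),
              group_sum (n N) (X N) 2 \<omega> / real (n N 2) powr (3/4)))) \<longlonglongrightarrow> (\<integral>p. f p \<partial>\<mu>)"
      using lim[OF f] by (simp only: \<mu>_int[OF fm])
  qed
  moreover have "moment K Q \<mu> = critical_moment \<alpha> L1 L2 K Q" for K Q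
    unfolding \<mu>_moment critical_moment_def
    using const[of K Q] by (simp add: \<alpha>1_def \<alpha>2_def h1_def h2_def)
  ultimately show ?thesis using \<mu> \<mu>_integrable by blast
qed

end
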